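(* Let $t\ge 2$ and $1\le m<t$ be integers. Then, as an identity of functions of the nonzero complex variable $x$ (wherever both sides are defined), \begin{align*}f_{t,m}(x) &= -\frac{q^{-\frac34t-\frac m2+\frac78}}{(q)_\infty^3} \sum_{k\bmod 2t} (-1)^k q^{\frac1{4t} (k-t)^2} \theta_{k-t,m} \underset{l\equiv k\ (\mathrm{mod}\ 2t)}{\sum_{r,l\in\mathbb{Z}}} \mathrm{sg}(r,l)\, (-1)^r q^{\frac12 r^2+lr+\frac{2t-1}{4t}l^2+\frac12 r + \frac12l} x^{-r}. \end{align*}
   Context: Let $q$ be a complex number with $0<|q|<1$ (fractional powers of $q$ are understood via $q=e^{2\pi i\tau}$, $\mathrm{Im}\,\tau>0$). Write $(x)_\infty=(x;q)_\infty=\prod_{i\ge0}(1-xq^i)$ and $\Theta(x;q):=(x)_\infty(q/x)_\infty(q)_\infty=\sum_{n\in\mathbb{Z}}(-1)^nq^{\binom n2}x^n$. Let $\mathrm{sg}(r)=1$ if $r\ge0$ and $-1$ if $r<0$, and $\mathrm{sg}(r,s):=(\mathrm{sg}(r)+\mathrm{sg}(s))/2$. For a positive integer $t$ and an integer $m$, define $$g_{t,m}(x):=\sum_{\substack{r,s\in\mathbb{Z}\\ r\not\equiv s\ (\mathrm{mod}\ 2)}} \mathrm{sg}(r,s)\, \frac{(-1)^{\frac{r-s-1}2} q^{\frac18 r^2 + \frac{4t-1}4rs+\frac18 s^2 +\frac{t+m}2r+\frac{t-m}2 s}}{1-xq^{\frac{r+s+1}2}},\qquad f_{t,m}(x):=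 -q^{-\frac t2-\frac m2+\frac78}\, \frac{\Theta(x;q)}{(q)_\infty^3}\, g_{t,m}(x),$$ and, for integers $p,m$, $$\theta_{p,m}:=\sum_{\substack{r,s\in\mathbb{Z}\\ r\not\equiv s\ (\mathrm{mod}\ 2)}} \mathrm{sg}(r,s)\,(-1)^{\frac{r-s-1}2} q^{\frac18 r^2 + \frac{4t-1}4rs+\frac18 s^2 +\frac{p+m}2r+\frac{p-m}2 s}.$$ *)

theory Defs
  imports "HOL-Analysis.Analysis" "HOL-Number_Theory.Cong"
begin

text \<open>
  Throughout, \<open>\<tau>\<close> is a point of the upper half-plane and \<open>q = exp (2 \<pi> i \<tau>)\<close>. All functions take
  \<open>\<tau>\<close> rather than \<open>q\<close> as a parameter, since \<open>\<tau>\<close> fixes the fractional powers of \<open>q\<close>.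
\<close>

definition qpow :: "complex \<Rightarrow> real \<Rightarrow> complex" where
  "qpow \<tau> a = exp (2 * of_real pi * \<i> * \<tau> * of_real a)"

definition qpoch_inf :: "complex \<Rightarrow> complex \<Rightarrow> complex" where
  "qpoch_inf x q = (\<Prod>i. 1 - x * q ^ i)"

definition Theta :: "complex \<Rightarrow> complex \<Rightarrow> complex" where
  "Theta x q = qpoch_inf x q * qpoch_inf (q / x) q * qpoch_inf q q"

text \<open>Unlike \<^const>\<open>sgn\<close>, the sign of \<open>0\<close> is \<open>1\<close>.\<close>

definition sg :: "int \<Rightarrow> complex" where
  "sg r = (if r \<ge> 0 then 1 else -1)"

definition sg2 :: "int \<Rightarrow> int \<Rightarrow> complex" where
  "sg2 r s = (sg r + sg s) / 2"

text \<open>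
  The double series below are unordered sums over sets of pairs of integers. The integer division
  by 2 in the sign is exact, because \<open>r\<close> and \<open>s\<close> have different parity. At \<open>x = 1\<close> the denominator
  of \<open>g\<close> vanishes only for \<open>r + s = -1\<close>, where \<open>sg2 r s = 0\<close>; these index pairs do not
  contribute to the sum, so that \<open>g\<close> has no pole there.
\<close>

definition g :: "complex \<Rightarrow> int \<Rightarrow> int \<Rightarrow> complex \<Rightarrow> complex" where
  "g \<tau> t m x =
    (\<Sum>\<^sub>\<infinity>(r, s) \<in> {(r, s). \<not> [r = s] (mod 2)}.
      sg2 r s * ((-1) powi ((r - s - 1) div 2) *
        qpow \<tau> (1/8 * of_int r ^ 2 + (4 * of_int t - 1) / 4 * of_int r * of_int s
                 + 1/8 * of_int s ^ 2
                 + of_int (t + m) / 2 * of_int r + of_int (t - m) / 2 * of_int s)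
        / (1 - x * qpow \<tau> (of_int (r + s + 1) / 2))))"

definition f :: "complex \<Rightarrow> int \<Rightarrow> int \<Rightarrow> complex \<Rightarrow> complex" where
  "f \<tau> t m x =
    - qpow \<tau> (- of_int t / 2 - of_int m / 2 + 7/8)
    * (Theta x (qpow \<tau> 1) / qpoch_inf (qpow \<tau> 1) (qpow \<tau> 1) ^ 3) * g \<tau> t m x"

definition theta :: "complex \<Rightarrow> int \<Rightarrow> int \<Rightarrow> int \<Rightarrow> complex" where
  "theta \<tau> t p m =
    (\<Sum>\<^sub>\<infinity>(r, s) \<in> {(r, s). \<not> [r = s] (mod 2)}.
      sg2 r s * (-1) powi ((r - s - 1) div 2) *
        qpow \<tau> (1/8 * of_int r ^ 2 + (4 * of_int t - 1) / 4 * of_int r * of_int s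
                 + 1/8 * of_int s ^ 2
                 + of_int (p + m) / 2 * of_int r + of_int (p - m) / 2 * of_int s))"

definition complete_residues :: "int \<Rightarrow> int set \<Rightarrow> bool" where
  "complete_residues n K \<longleftrightarrow> bij_betw (\<lambda>k. k mod n) K {0..<n}"

end

theory Submission
  imports Defs
begin

text \<open>
  By the Jacobi triple product, multiplying the Laurent series
  \<open>\<Sum> sg(R, l) (-1)\<^bsup>R+l\<^esup> q\<^bsup>(R+l)(R+l+1)/2 + N l\<^esup> x\<^bsup>-R\<^esup>\<close> by \<open>1 - x q\<^sup>N\<close> telescopes it to \<open>\<Theta>(x; q)\<close>.
  Insert this expansion of \<open>\<Theta>(x; q) / (1 - x q\<^sup>N)\<close> with \<open>N = (r + s + 1) / 2\<close> into \<open>\<Theta>(x; q) g(x)\<close>.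
  The resulting fourfold series in \<open>(r, s, R, l)\<close> converges absolutely, and summing over \<open>(r, s)\<close> first
  turns the inner sum into \<open>\<theta>\<^bsub>t+l,m\<^esub>\<close> up to a power of \<open>q\<close>. Shifting \<open>(r, s)\<close> by \<open>(1, 1)\<close> gives
  \<open>\<theta>\<^bsub>p,m\<^esub> = q\<^bsup>t+p\<^esup> \<theta>\<^bsub>p+2t,m\<^esub>\<close>, since the boundary terms are theta series that vanish. Hence
  \<open>(-1)\<^sup>k q\<^bsup>(k-t)^2/(4t)\<^esup> \<theta>\<^bsub>k-t,m\<^esub>\<close> depends only on \<open>k\<close> modulo \<open>2 t\<close>, and the sum over \<open>l\<close> can be
  collected by residue classes.
\<close>

subsection \<open>Powers of \<open>q\<close> and summability\<close>

lemma qpow_add: "qpow \<tau> (a + b) = qpow \<tau> a * qpow \<tau> b"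
  by (simp add: qpow_def ring_distribs exp_add)

lemma qpow_0 [simp]: "qpow \<tau> 0 = 1"
  by (simp add: qpow_def)

lemma qpow_nonzero [simp]: "qpow \<tau> a \<noteq> 0"
  by (simp add: qpow_def)

lemma qpow_minus: "qpow \<tau> (- a) = inverse (qpow \<tau> a)"
  by (simp add: qpow_def exp_minus)

lemma qpow_diff: "qpow \<tau> (a - b) = qpow \<tau> a / qpow \<tau> b"
  by (simp add: qpow_def right_diff_distrib exp_diff)

lemma qpow_of_nat: "qpow \<tau> (of_nat n) = qpow \<tau> 1 ^ n"
  by (induction n) (simp_all add: qpow_add)

lemma norm_qpow: "norm (qpow \<tau> a) = exp (- (2 * pi * Im \<tau>) * a)"
  by (simp add: qpow_def)

lemma norm_qpow_1_less: "Im \<tau> > 0 \<Longrightarrow> norm (qpow \<tau> 1) < 1"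
  by (simp add: norm_qpow)

lemma minus_one_powi_even: "even k \<Longrightarrow> (-1 :: complex) powi k = 1"
  by (auto simp: power_int_def even_nat_iff)

lemma minus_one_powi_odd: "odd k \<Longrightarrow> (-1 :: complex) powi k = -1"
  by (auto simp: power_int_def even_nat_iff)

lemma minus_one_powi_cong: "even (j - k) \<Longrightarrow> (-1 :: complex) powi j = (-1) powi k"
  by (cases "even k") (auto simp: minus_one_powi_even minus_one_powi_odd)

lemma minus_one_powi_opp: "odd (j - k) \<Longrightarrow> (-1 :: complex) powi j = - ((-1) powi k)"
  by (cases "even k") (auto simp: minus_one_powi_even minus_one_powi_odd)

lemma norm_minus_one_powi [simp]: "norm ((-1 :: complex) powi k) = 1"
  by (simp add: norm_power_int)

section \<open>Summability over the integers and over product sets\<close>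

lemma summable_on_exp_abs_int:
  fixes d :: real
  assumes "d > 0"
  shows "(\<lambda>n::int. exp (- d * \<bar>of_int n\<bar>)) summable_on UNIV"
proof -
  have "summable (\<lambda>n. norm (exp (- d) ^ n))"
    using assms by (simp add: norm_power summable_geometric)
  then have *: "(\<lambda>n::nat. exp (- d) ^ n) summable_on UNIV"
    by (rule norm_summable_imp_summable_on)
  have eq: "exp (- d) ^ n = exp (- d * of_nat n)" for n :: nat
    by (simp add: exp_of_nat_mult [symmetric] mult.commute)
  have "(\<lambda>n::int. exp (- d * \<bar>of_int n\<bar>)) summable_on range int"
    using * by (subst summable_on_reindex) (simp_all add: o_def eq)
  moreover have "(\<lambda>n::int. exp (- d * \<bar>of_int n\<bar>)) summable_on range (\<lambda>n. - int n)"
    using * by (subst summable_on_reindex) (simp_all add: o_def eq inj_on_def)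
  ultimately have "(\<lambda>n::int. exp (- d * \<bar>of_int n\<bar>)) summable_on (range int \<union> range (\<lambda>n. - int n))"
    by (rule summable_on_union)
  moreover have "range int \<union> range (\<lambda>n. - int n) = UNIV"
  proof (intro set_eqI iffI UNIV_I)
    fix n :: int
    show "n \<in> range int \<union> range (\<lambda>n. - int n)"
      by (cases n rule: int_cases2) auto
  qed
  ultimately show ?thesis by simp
qed

lemma summable_on_Times_mult:
  fixes f :: "'a \<Rightarrow> real" and g :: "'b \<Rightarrow> real"
  assumes "f summable_on A" "g summable_on B"
    and "\<And>x. x \<in> A \<Longrightarrow> f x \<ge> 0" "\<And>y. y \<in> B \<Longrightarrow> g y \<ge> 0"
  shows "(\<lambda>(x, y). f x * g y) summable_on (A \<times> B)"
proof (rule summable_on_SigmaI)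
  show "((\<lambda>y. case (x, y) of (x, y) \<Rightarrow> f x * g y) has_sum (f x * infsum g B)) B" for x
    using has_sum_cmult_right [OF has_sum_infsum [OF assms(2)], of "f x"] by simp
  show "(\<lambda>x. f x * infsum g B) summable_on A"
    using assms(1) by (rule summable_on_cmult_left)
qed (use assms in auto)

lemma norm_powi_exp:
  fixes x :: complex
  assumes "x \<noteq> 0"
  shows "norm (x powi k) = exp (of_int k * ln (norm x))"
proof -
  have "norm (x powi k) = norm x powi k"
    by (simp add: norm_power_int)
  also have "\<dots> = norm x powr of_int k"
    using assms by (simp add: powr_real_of_int')
  finally show ?thesis using assms by (simp add: powr_def)
qed

section \<open>Convergence of the infinite product and passage to the limit in series\<close>

lemma one_minus_power_nonzero:
  fixes q :: complex
  assumes "norm q < 1"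
  shows "1 - q * q ^ i \<noteq> 0"
proof -
  have "norm (q ^ Suc i) < 1"
    using assms by (subst norm_power, subst power_less_one_iff) auto
  then show ?thesis by auto
qed

lemma qpoch_convergent_prod:
  fixes q x :: complex
  assumes "norm q < 1"
  shows "convergent_prod (\<lambda>i. 1 - x * q ^ i)"
proof -
  have "summable (\<lambda>i. norm x * norm q ^ i)"
    using assms by (intro summable_mult summable_geometric) auto
  then have "abs_convergent_prod (\<lambda>i. 1 - x * q ^ i)"
    by (intro summable_imp_abs_convergent_prod) (simp add: norm_mult norm_power)
  then show ?thesis
    by (rule abs_convergent_prod_imp_convergent_prod)
qed

lemma qpoch_inf_tendsto:
  assumes "norm q < 1"
  shows "(\<lambda>n. \<Prod>i<n. 1 - x * q ^ i) \<longlonglongrightarrow> qpoch_inf x q"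
proof -
  have "(\<lambda>n. \<Prod>i\<le>n. 1 - x * q ^ i) \<longlonglongrightarrow> qpoch_inf x q"
    unfolding qpoch_inf_def
    using assms by (intro convergent_prod_LIMSEQ qpoch_convergent_prod)
  then have "(\<lambda>n. \<Prod>i<Suc n. 1 - x * q ^ i) \<longlonglongrightarrow> qpoch_inf x q"
    by (simp add: lessThan_Suc_atMost)
  then show ?thesis
    by (rule LIMSEQ_imp_Suc)
qed

lemma qpoch_inf_self_nonzero: "norm q < 1 \<Longrightarrow> qpoch_inf q q \<noteq> 0"
  unfolding qpoch_inf_def using one_minus_power_nonzero
  by (intro prodinf_nonzero qpoch_convergent_prod) auto

text \<open>Tannery's theorem, moved from the naturals to the integers along the bijection
  \<open>int_decode\<close>. It justifies the limit in the finite triple product.\<close>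

lemma has_sum_dominated_int:
  fixes a :: "nat \<Rightarrow> int \<Rightarrow> complex"
  assumes lim: "\<And>k. (\<lambda>n. a n k) \<longlonglongrightarrow> b k"
    and bound: "\<And>n k. norm (a n k) \<le> M k"
    and M: "M summable_on UNIV"
    and sums: "\<And>n. (a n has_sum S n) UNIV"
    and S: "S \<longlonglongrightarrow> L"
  shows "(b has_sum L) UNIV"
proof -
  have bij: "bij_betw int_decode UNIV UNIV"
    by (rule bij_int_decode)
  have "(\<lambda>j. M (int_decode j)) summable_on UNIV"
    using M by (subst summable_on_reindex_bij_betw [OF bij])
  then have sM: "summable (\<lambda>j. M (int_decode j))"
    by (rule summable_on_imp_summable)
  have *: "summable (\<lambda>j. norm (b (int_decode j))) \<and>
        (\<lambda>n. \<Sum>j. a n (int_decode j)) \<longlonglongrightarrow> (\<Sum>j. b (int_decode j))"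
    using tannerys_theorem [of "\<lambda>j n. a n (int_decode j)" "\<lambda>j. b (int_decode j)" sequentially
        "\<lambda>j. M (int_decode j)"] lim sM bound by (simp add: always_eventually case_prod_beta)
  have "(\<Sum>j. a n (int_decode j)) = S n" for n
  proof -
    have "((\<lambda>j. a n (int_decode j)) has_sum S n) UNIV"
      using sums by (subst has_sum_reindex_bij_betw [OF bij])
    then show ?thesis
      by (intro sums_unique [symmetric] has_sum_imp_sums)
  qed
  then have "S \<longlonglongrightarrow> (\<Sum>j. b (int_decode j))"
    using * by simp
  then have "(\<Sum>j. b (int_decode j)) = L"
    using S LIMSEQ_unique by blast
  then have "((\<lambda>j. b (int_decode j)) has_sum L) UNIV"
    using * by (intro norm_summable_imp_has_sum) (auto dest: summable_norm_cancel simp: sums_iff)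
  then show ?thesis
    by (subst (asm) has_sum_reindex_bij_betw [OF bij])
qed

subsection \<open>The Jacobi triple product\<close>

text \<open>The finite product (q; q)_n, which tends to \<open>qpoch_inf q q\<close>.\<close>

definition qfac :: "complex \<Rightarrow> nat \<Rightarrow> complex" where
  "qfac q n = (\<Prod>i<n. 1 - q * q ^ i)"

text \<open>
  The value \<open>0\<close> at negative arguments makes \<open>inv_qfac_pred\<close> hold for all integers, so that the
  Gaussian binomial coefficients below need no side conditions.
\<close>

definition inv_qfac :: "complex \<Rightarrow> int \<Rightarrow> complex" where
  "inv_qfac q k = (if k < 0 then 0 else inverse (qfac q (nat k)))"

lemma qfac_nonzero: "norm q < 1 \<Longrightarrow> qfac q n \<noteq> 0"
  using one_minus_power_nonzero by (simp add: qfac_def)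

lemma qfac_Suc: "qfac q (Suc n) = qfac q n * (1 - q * q ^ n)"
  by (simp add: qfac_def)

text \<open>For positive \<open>k\<close> this is the recurrence of \<open>qfac\<close>; at
  \<open>k = 0\<close> the factor \<open>1 - qpow \<tau> 0\<close> vanishes, and for negative
  \<open>k\<close> both reciprocals are 0.\<close>

lemma inv_qfac_pred:
  assumes "Im \<tau> > 0"
  shows "inv_qfac (qpow \<tau> 1) (k - 1) = (1 - qpow \<tau> (of_int k)) * inv_qfac (qpow \<tau> 1) k"
proof (cases "k \<le> 0")
  case True
  then show ?thesis by (cases "k = 0") (auto simp: inv_qfac_def)
next
  case False
  then obtain n where n: "k = int (Suc n)"
    by (metis gr0_implies_Suc not_le zero_less_imp_eq_int)
  have *: "1 - qpow \<tau> 1 * qpow \<tau> 1 ^ n \<noteq> 0"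
    using one_minus_power_nonzero norm_qpow_1_less assms by blast
  have "nat (1 + int n) = Suc n" by simp
  with * n show ?thesis
    using qfac_nonzero [OF norm_qpow_1_less [OF assms]]
    by (simp add: inv_qfac_def qfac_Suc qpow_add qpow_of_nat)
qed

text \<open>The weights are the Gaussian binomials of 2n over n + k. In the induction the new pair
  of factors couples the coefficients at \<open>k - 1\<close>, \<open>k\<close> and
  \<open>k + 1\<close>, and the claim reduces to a recurrence for the weights.\<close>

lemma finite_jacobi_triple_product:
  assumes \<tau>: "Im \<tau> > 0" and x: "x \<noteq> 0"
  defines "q \<equiv> qpow \<tau> 1"
  shows "((\<lambda>k. (-1) powi k * qpow \<tau> (of_int (k * (k - 1)) / 2) * x powi k
            * (qfac q (2 * n) * inv_qfac q (int n + k) * inv_qfac q (int n - k)))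
          has_sum (\<Prod>i<n. (1 - x * q ^ i) * (1 - q / x * q ^ i))) UNIV"
proof (induction n)
  case 0
  have "inv_qfac q k * inv_qfac q (- k) = (if k = 0 then 1 else 0)" for k
    by (auto simp: inv_qfac_def qfac_def)
  then show ?case
    by (intro has_sum_finite_neutralI [where B = "{0}"]) (auto simp: qfac_def inv_qfac_def)
next
  case (Suc n)
  define b where "b k = (-1) powi k * qpow \<tau> (of_int (k * (k - 1)) / 2) * x powi k" for k :: int
  define c where "c n k = qfac q (2 * n) * inv_qfac q (int n + k) * inv_qfac q (int n - k)" for n k
  define P where "P n = (\<Prod>i<n. (1 - x * q ^ i) * (1 - q / x * q ^ i))" for n
  define Q where "Q = q ^ n"
  have q0: "q \<noteq> 0" and Q0: "Q \<noteq> 0" by (simp_all add: q_def Q_def)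
  have QQ: "Q = qpow \<tau> (of_nat n)" by (simp add: Q_def q_def qpow_of_nat)
  have IH: "((\<lambda>k. b k * c n k) has_sum P n) UNIV"
    using Suc.IH by (simp add: b_def c_def P_def)
  have shift: "((\<lambda>k. b (k + j) * c n (k + j)) has_sum P n) UNIV" for j
    using has_sum_reindex_bij_betw [of "\<lambda>k. k + j" UNIV UNIV "\<lambda>k. b k * c n k" "P n"] IH
      bij_plus_right [of j] by simp
  \<comment> \<open>The three constants are the terms of
    \<open>(1 - x * Q) * (1 - q * Q / x)\<close>; the sums multiplied by \<open>x\<close> and
    \<open>1 / x\<close> are reindexed so that all three are aligned at the same power of
    \<open>x\<close>.\<close>
  have "((\<lambda>k. (1 + q * Q^2) * (b k * c n k) + (- (Q * x)) * (b (k + (-1)) * c n (k + (-1)))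
            + (- (q * Q / x)) * (b (k + 1) * c n (k + 1)))
        has_sum ((1 + q * Q^2) * P n + (- (Q * x)) * P n + (- (q * Q / x)) * P n)) UNIV"
    by (intro has_sum_add has_sum_cmult_right IH shift)
  moreover have "(1 + q * Q^2) * P n + (- (Q * x)) * P n + (- (q * Q / x)) * P n = P (Suc n)"
    using x by (simp add: P_def Q_def field_simps power2_eq_square)
  moreover have "(1 + q * Q^2) * (b k * c n k) + (- (Q * x)) * (b (k + (-1)) * c n (k + (-1)))
            + (- (q * Q / x)) * (b (k + 1) * c n (k + 1)) = b k * c (Suc n) k" for k
  proof -
    define z where "z = qpow \<tau> (of_int k)"
    have z0: "z \<noteq> 0" by (simp add: z_def)
    \<comment> \<open>\<open>A\<close> and \<open>B\<close> have the largest arguments that occur.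
      The other reciprocals are multiples of them by polynomials in \<open>z\<close> and
      \<open>1 / z\<close>, so no factor that might vanish is divided by.\<close>
    define A where "A = inv_qfac q (int n + 1 + k)"
    define B where "B = inv_qfac q (int n + 1 - k)"
    have pred: "inv_qfac q (j - 1) = (1 - qpow \<tau> (of_int j)) * inv_qfac q j" for j
      using inv_qfac_pred [OF \<tau>] by (simp add: q_def)
    have E: "qpow \<tau> (of_int (int n + 1 + k)) = Q * q * z" "qpow \<tau> (of_int (int n + k)) = Q * z"
      "qpow \<tau> (of_int (int n + 1 - k)) = Q * q / z" "qpow \<tau> (of_int (int n - k)) = Q / z"
      unfolding of_int_add of_int_diff by (simp_all add: QQ q_def z_def qpow_add qpow_diff)
    have A1: "inv_qfac q (int n + k) = (1 - Q * q * z) * A"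
      using pred [of "int n + 1 + k"] unfolding E A_def by simp
    have A2: "inv_qfac q (int n + k - 1) = (1 - Q * z) * (1 - Q * q * z) * A"
      using pred [of "int n + k"] unfolding E A1 by simp
    have B1: "inv_qfac q (int n - k) = (1 - Q * q / z) * B"
      using pred [of "int n + 1 - k"] unfolding E B_def by simp
    have B2: "inv_qfac q (int n - k - 1) = (1 - Q / z) * (1 - Q * q / z) * B"
      using pred [of "int n - k"] unfolding E B1 by simp
    have F: "qfac q (2 * Suc n) = qfac q (2 * n) * (1 - q * Q^2) * (1 - q^2 * Q^2)"
    proof -
      have "q ^ (2 * n) = Q^2" by (simp add: Q_def power_even_eq)
      moreover have "2 * Suc n = Suc (Suc (2 * n))" by simp
      ultimately show ?thesis by (simp only: qfac_Suc power_Suc power2_eq_square mult.assoc)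
    qed
    have b1: "b (k + 1) = - (x * z) * b k"
    proof -
      have *: "of_int ((k + 1) * (k + 1 - 1)) / 2 = of_int (k * (k - 1)) / 2 + (of_int k :: real)"
        by (simp add: field_simps)
      show ?thesis
        unfolding b_def * qpow_add using x by (simp add: power_int_add z_def)
    qed
    have b2: "- (Q * x) * b (k + (-1)) = Q * q / z * b k"
    proof -
      have *: "of_int ((k + (-1)) * (k + (-1) - 1)) / 2 = of_int (k * (k - 1)) / 2 - (of_int k :: real) + 1"
        by (simp add: field_simps)
      show ?thesis
        unfolding b_def * qpow_add qpow_diff using x by (simp add: power_int_diff z_def q_def)
    qed
    have c0: "c n k = qfac q (2 * n) * ((1 - Q * q * z) * A) * ((1 - Q * q / z) * B)"
      by (simp add: c_def A1 B1)
    have c1: "c n (k + (-1)) = qfac q (2 * n) * ((1 - Q * z) * (1 - Q * q * z) * A) * B"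
    proof -
      have "int n + (k + (-1)) = int n + k - 1" "int n - (k + (-1)) = int n + 1 - k" by simp_all
      then show ?thesis by (simp only: c_def A2 B_def)
    qed
    have c2: "c n (k + 1) = qfac q (2 * n) * A * ((1 - Q / z) * (1 - Q * q / z) * B)"
    proof -
      have "int n + (k + 1) = int n + 1 + k" "int n - (k + 1) = int n - k - 1" by simp_all
      then show ?thesis by (simp only: c_def B2 A_def)
    qed
    have c3: "c (Suc n) k = qfac q (2 * n) * (1 - q * Q^2) * (1 - q^2 * Q^2) * A * B"
    proof -
      have "int (Suc n) + k = int n + 1 + k" "int (Suc n) - k = int n + 1 - k" by simp_all
      then show ?thesis by (simp only: c_def F A_def B_def)
    qed
    \<comment> \<open>What remains of the recurrence after the common factor
      \<open>qfac q (2 * n) * A * B\<close> is removed, with \<open>z\<close> for the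
      \<open>k\<close>-th and \<open>Q\<close> for the \<open>n\<close>-th power of
      \<open>q\<close>.\<close>
    have key: "(1 + q * Q^2) * ((1 - Q * q * z) * (1 - Q * q / z))
          + Q * q / z * ((1 - Q * z) * (1 - Q * q * z))
          + q * Q * z * ((1 - Q / z) * (1 - Q * q / z)) = (1 - q * Q^2) * (1 - q^2 * Q^2)"
      using z0 by (simp add: field_simps power2_eq_square)
    have factor: "u * (y * (F * (a1 * A') * (b1 * B'))) + v * y * (F * (a2 * a1 * A') * B')
          + w * y * (F * A' * (b2 * b1 * B'))
        = y * (F * A' * B') * (u * (a1 * b1) + v * (a2 * a1) + w * (b2 * b1))"
      for u v w y F A' B' a1 a2 b1 b2 :: complex
      by (simp add: algebra_simps)
    have "(- (Q * x)) * (b (k + (-1)) * c n (k + (-1))) = Q * q / z * b k * c n (k + (-1))"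
      using b2 by (metis mult.assoc)
    moreover have "(- (q * Q / x)) * (b (k + 1) * c n (k + 1)) = q * Q * z * b k * c n (k + 1)"
      unfolding b1 using x by simp
    ultimately show ?thesis
      by (simp only: c0 c1 c2 c3 factor key) (simp only: mult_ac)
  qed
  ultimately show ?case
    by (simp add: b_def c_def P_def)
qed

text \<open>The limit of the finite form: each Gaussian binomial tends to \<open>inverse L\<close>.
  The weights are bounded uniformly in \<open>n\<close> and \<open>k\<close>, so the absolutely
  summable \<open>b\<close> dominates, and multiplication by \<open>L\<close> supplies the third
  product in \<open>Theta\<close>.\<close>

theorem jacobi_triple_product:
  assumes \<tau>: "Im \<tau> > 0" and x: "x \<noteq> 0"
  shows "((\<lambda>k. (-1) powi k * qpow \<tau> (of_int (k * (k - 1)) / 2) * x powi k)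
          has_sum Theta x (qpow \<tau> 1)) UNIV"
proof -
  define q where "q = qpow \<tau> 1"
  have q1: "norm q < 1" unfolding q_def using \<tau> by (rule norm_qpow_1_less)
  define b where "b k = (-1) powi k * qpow \<tau> (of_int (k * (k - 1)) / 2) * x powi k" for k :: int
  define w where "w n k = qfac q (2 * n) * inv_qfac q (int n + k) * inv_qfac q (int n - k)" for n k
  define L where "L = qpoch_inf q q"
  have L0: "L \<noteq> 0" unfolding L_def using q1 by (rule qpoch_inf_self_nonzero)
  have lim: "(\<lambda>n. qfac q n) \<longlonglongrightarrow> L"
    using qpoch_inf_tendsto [OF q1, of q] unfolding qfac_def L_def .
  have lim_inv: "(\<lambda>n. inverse (qfac q n)) \<longlonglongrightarrow> inverse L"
    using lim L0 by (rule tendsto_inverse)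
  from lim obtain C1 where C1: "\<And>n. norm (qfac q n) \<le> C1"
    by (metis Bseq_def convergentI convergent_imp_Bseq)
  from lim_inv obtain C2 where C2: "C2 > 0" "\<And>n. norm (inverse (qfac q n)) \<le> C2"
    by (metis Bseq_def convergentI convergent_imp_Bseq)
  have C1_nonneg: "C1 \<ge> 0" using C1 [of 0] norm_ge_zero order_trans by blast
  have inv_bound: "norm (inv_qfac q k) \<le> C2" for k
    using C2 by (auto simp: inv_qfac_def)
  have inv_lim: "(\<lambda>n. inv_qfac q (int n + k)) \<longlonglongrightarrow> inverse L" for k
  proof -
    have "filterlim (\<lambda>n. nat (int n + k)) at_top sequentially"
      unfolding filterlim_at_top
    proof
      fix Z
      show "eventually (\<lambda>n. Z \<le> nat (int n + k)) sequentially"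
        using eventually_ge_at_top [of "nat (int Z + \<bar>k\<bar>)"] by eventually_elim linarith
    qed
    from filterlim_compose [OF lim_inv this]
    have "(\<lambda>n. inverse (qfac q (nat (int n + k)))) \<longlonglongrightarrow> inverse L" .
    moreover have "eventually (\<lambda>n. inverse (qfac q (nat (int n + k))) = inv_qfac q (int n + k)) sequentially"
      using eventually_ge_at_top [of "nat \<bar>k\<bar>"] by eventually_elim (auto simp: inv_qfac_def)
    ultimately show ?thesis by (rule Lim_transform_eventually)
  qed
  have "((\<lambda>k. b k * inverse L) has_sum qpoch_inf x q * qpoch_inf (q / x) q) UNIV"
  proof (rule has_sum_dominated_int)
    show "(\<lambda>n. b k * w n k) \<longlonglongrightarrow> b k * inverse L" for k
    proof -
      have "(\<lambda>n. qfac q (2 * n)) \<longlonglongrightarrow> L"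
        using filterlim_compose [OF lim mult_nat_left_at_top [of 2]] by simp
      then have "(\<lambda>n. b k * w n k) \<longlonglongrightarrow> b k * (L * inverse L * inverse L)"
        unfolding w_def using inv_lim [of k] inv_lim [of "- k"] by (intro tendsto_intros) simp_all
      then show ?thesis using L0 by simp
    qed
    show "norm (b k * w n k) \<le> norm (b k) * (C1 * C2 * C2)" for n k
      unfolding w_def norm_mult using C1 inv_bound C1_nonneg C2(1)
      by (intro mult_left_mono mult_mono) auto
    show "(\<lambda>k. norm (b k) * (C1 * C2 * C2)) summable_on UNIV"
    proof -
      define K where "K = 2 * pi * Im \<tau>"
      define X where "X = ln (norm x)"
      have K: "K > 0" using \<tau> by (simp add: K_def)
      \<comment> \<open>Set aside \<open>K * u\<close> for geometric decay, where \<open>u\<close>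
        is the absolute value of \<open>k\<close>. \<open>D\<close> is an upper bound for the
        concave quadratic in \<open>u\<close> that is left; the square in the proof below exhibits
        it.\<close>
      define D where "D = (\<bar>X\<bar> + 2 * K)\<^sup>2 / (2 * K)"
      have "norm (b k) \<le> exp D * exp (- K * \<bar>of_int k\<bar>)" for k
      proof -
        define u :: real where "u = \<bar>of_int k\<bar>"
        have "norm (b k) = exp (- K * (of_int k * (of_int k - 1) / 2) + of_int k * X)"
          using x by (simp add: b_def norm_mult norm_qpow norm_powi_exp K_def X_def exp_add [symmetric])
        also have "\<dots> \<le> exp (D - K * u)"
        proof -
          have "of_int k * (of_int k - 1 :: real) \<ge> u\<^sup>2 - u"
            by (simp add: u_def power2_eq_square algebra_simps)
          then have "K * (of_int k * (of_int k - 1) / 2) \<ge> K * ((u\<^sup>2 - u) / 2)"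
            using K by (intro mult_left_mono divide_right_mono) auto
          moreover have "of_int k * X \<le> u * \<bar>X\<bar>"
            unfolding u_def by (metis abs_ge_self abs_mult)
          moreover have "u * \<bar>X\<bar> + K * u - K * ((u\<^sup>2 - u) / 2) \<le> D"
          proof -
            have "0 \<le> (K * u - (\<bar>X\<bar> + 2 * K))\<^sup>2" by simp
            then have "2 * K * (u * \<bar>X\<bar> + K * u - K * ((u\<^sup>2 - u) / 2)) + K\<^sup>2 * u \<le> (\<bar>X\<bar> + 2 * K)\<^sup>2"
              by (simp add: power2_eq_square field_simps)
            moreover have "K\<^sup>2 * u \<ge> 0" by (simp add: u_def)
            ultimately have "2 * K * (u * \<bar>X\<bar> + K * u - K * ((u\<^sup>2 - u) / 2)) \<le> (\<bar>X\<bar> + 2 * K)\<^sup>2"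
              by linarith
            then show ?thesis
              unfolding D_def using K by (simp add: pos_le_divide_eq mult.commute)
          qed
          ultimately show ?thesis by simp
        qed
        finally show ?thesis by (simp add: u_def exp_diff exp_minus field_simps)
      qed
      then have "(\<lambda>k. norm (b k)) summable_on UNIV"
        by (intro Infinite_Sum.abs_summable_on_comparison_test' [OF
              summable_on_cmult_right [OF summable_on_exp_abs_int [OF K], of "exp D"]]) auto
      then show ?thesis by (rule summable_on_cmult_left)
    qed
    show "((\<lambda>k. b k * w n k) has_sum (\<Prod>i<n. 1 - x * q ^ i) * (\<Prod>i<n. 1 - q / x * q ^ i)) UNIV" for n
      using finite_jacobi_triple_product [OF assms, of n]
      by (simp add: b_def w_def q_def prod.distrib mult.assoc)
    show "(\<lambda>n. (\<Prod>i<n. 1 - x * q ^ i) * (\<Prod>i<n. 1 - q / x * q ^ i))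
        \<longlonglongrightarrow> qpoch_inf x q * qpoch_inf (q / x) q"
      by (intro tendsto_mult qpoch_inf_tendsto q1)
  qed
  from has_sum_cmult_left [OF this, of L] L0 show ?thesis
    by (simp add: b_def Theta_def L_def q_def mult.assoc)
qed

subsection \<open>Partial fractions of the theta function\<close>

lemma qpow_powi: "qpow \<tau> a powi k = qpow \<tau> (a * of_int k)"
proof (cases k rule: int_cases2)
  case (nonneg n)
  then show ?thesis
    by (simp add: qpow_def exp_of_nat_mult [symmetric] mult_ac)
next
  case (nonpos n)
  then show ?thesis
    by (simp add: power_int_minus qpow_minus) (simp add: qpow_def exp_of_nat_mult [symmetric] mult_ac)
qed

text \<open>The involution \<open>k \<mapsto> 1 - 2 * N - k\<close> changes the sign of every term.\<close>

lemma alternating_line_sum_zero: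
  assumes "Im \<tau> > 0"
  shows "((\<lambda>k. (-1) powi k * qpow \<tau> (of_int (k * (k - 1)) / 2 + of_int N * of_int k)) has_sum 0) UNIV"
proof -
  define e where "e k = (-1) powi k * qpow \<tau> (of_int (k * (k - 1)) / 2 + of_int N * of_int k)" for k
  define S where "S = Theta (qpow \<tau> (of_int N)) (qpow \<tau> 1)"
  have S: "(e has_sum S) UNIV"
    using jacobi_triple_product [OF assms, of "qpow \<tau> (of_int N)"]
    by (simp add: e_def [abs_def] S_def qpow_powi qpow_add mult.assoc)
  have "bij (\<lambda>k. 1 - 2 * N - k)"
    by (rule involuntory_imp_bij) simp
  then have "((\<lambda>k. e (1 - 2 * N - k)) has_sum S) UNIV"
    using S by (subst has_sum_reindex_bij_betw)
  moreover have "e (1 - 2 * N - k) = - e k" for k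
  proof -
    have "of_int ((1 - 2 * N - k) * (1 - 2 * N - k - 1)) / 2 + of_int N * of_int (1 - 2 * N - k)
        = of_int (k * (k - 1)) / 2 + of_int N * (of_int k :: real)"
      by (simp add: field_simps)
    moreover have "(-1 :: complex) powi (1 - 2 * N - k) = - ((-1) powi k)"
      by (rule minus_one_powi_opp) presburger
    ultimately show ?thesis
      unfolding e_def by simp
  qed
  ultimately have "((\<lambda>k. - e k) has_sum S) UNIV"
    by simp
  then have "((\<lambda>k. e k) has_sum - S) UNIV"
    by (simp add: has_sum_uminus)
  with S have "S = - S"
    using has_sum_unique by blast
  then show ?thesis
    using S by (simp add: e_def [abs_def])
qed

text \<open>Turns a sum along a line into a sum over lattice points whose terms vanish off that
  line.\<close>

lemma has_sum_inj_support:
  assumes "inj_on h B" "h ` B \<subseteq> A" "\<And>y. y \<in> A - h ` B \<Longrightarrow> F y = 0"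
    and "((\<lambda>x. F (h x)) has_sum S) B"
  shows "(F has_sum S) A"
proof -
  have "(F has_sum S) (h ` B)"
    using assms by (simp add: has_sum_reindex o_def)
  then show ?thesis
    using assms by (subst has_sum_cong_neutral [where T = "h ` B" and g = F]) auto
qed

text \<open>\<open>sg\<close> jumps by 2 between -1 and 0, so \<open>sg2\<close> changes by 1 for
  each coordinate that crosses this gap. Here \<open>l\<close> and \<open>R\<close> move in opposite
  directions, whence the opposite signs.\<close>

lemma sg2_diff_anti:
  "sg2 R l - sg2 (R + 1) (l - 1) = (if l = 0 then 1 else 0) - (if R = -1 then 1 else 0)"
  by (auto simp: sg2_def sg_def)

lemma sg2_diff_diag:
  "sg2 (r + 1) (s + 1) - sg2 r s = (if r = -1 then 1 else 0) + (if s = -1 then 1 else 0)"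
  by (auto simp: sg2_def sg_def)

text \<open>Up to the factor \<open>sg2 R l\<close>, the term of the double series for
  \<open>Theta\<close> divided by \<open>1 - x * qpow \<tau> (of_int N)\<close>. The quadratic part
  depends only on \<open>R + l\<close>, so the step from \<open>(R, l)\<close> to
  \<open>(R + 1, l - 1)\<close> divides the term by
  \<open>x * qpow \<tau> (of_int N)\<close>.\<close>

definition kernel_term :: "complex \<Rightarrow> complex \<Rightarrow> int \<Rightarrow> int \<Rightarrow> int \<Rightarrow> complex" where
  "kernel_term \<tau> x N R l =
    (-1) powi (R + l) * qpow \<tau> (of_int ((R + l) * (R + l + 1)) / 2 + of_int N * of_int l) * x powi (- R)"

text \<open>
  The factor \<open>1 - x q\<^sup>N\<close> telescopes the series along \<open>(R, l) \<mapsto> (R + 1, l - 1)\<close>; only the sign jumps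
  on the lines \<open>l = 0\<close> and \<open>R = -1\<close> survive, the second of which sums to \<open>0\<close>.
\<close>

lemma kernel_sum:
  assumes \<tau>: "Im \<tau> > 0" and x: "x \<noteq> 0"
    and sum: "(\<lambda>(R, l). sg2 R l * kernel_term \<tau> x N R l) summable_on UNIV"
  shows "(1 - x * qpow \<tau> (of_int N)) * (\<Sum>\<^sub>\<infinity>(R, l). sg2 R l * kernel_term \<tau> x N R l)
    = Theta x (qpow \<tau> 1)"
proof -
  define e where "e = kernel_term \<tau> x N"
  define S where "S = (\<Sum>\<^sub>\<infinity>(R, l). sg2 R l * kernel_term \<tau> x N R l)"
  have S: "((\<lambda>(R, l). sg2 R l * e R l) has_sum S) UNIV"
    unfolding S_def e_def using sum by (rule has_sum_infsum)
  have "bij (\<lambda>(R :: int, l :: int). (R + 1, l - 1))"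
    by (rule bij_betw_byWitness [where f' = "\<lambda>(R, l). (R - 1, l + 1)"]) auto
  from has_sum_reindex_bij_betw [OF this, of "\<lambda>(R, l). sg2 R l * e R l" S] S
  have "((\<lambda>(R, l). sg2 (R + 1) (l - 1) * e (R + 1) (l - 1)) has_sum S) UNIV"
    by (simp add: case_prod_unfold)
  from has_sum_cmult_right [OF this, of "x * qpow \<tau> (of_int N)"]
  have "((\<lambda>(R, l). x * qpow \<tau> (of_int N) * (sg2 (R + 1) (l - 1) * e (R + 1) (l - 1)))
      has_sum x * qpow \<tau> (of_int N) * S) UNIV"
    by (simp add: case_prod_unfold)
  moreover have "x * qpow \<tau> (of_int N) * (sg2 (R + 1) (l - 1) * e (R + 1) (l - 1))
      = sg2 (R + 1) (l - 1) * e R l" for R l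
  proof -
    have 1: "(R + 1) + (l - 1) = R + l" by simp
    have 2: "of_int ((R + l) * (R + l + 1)) / 2 + of_int N * of_int l
        = (of_int ((R + l) * (R + l + 1)) / 2 + of_int N * of_int (l - 1)) + (of_int N :: real)"
      by (simp add: algebra_simps)
    have 3: "x powi (- R) = x * x powi (- (R + 1))"
      using x by (simp add: power_int_diff)
    show ?thesis
      unfolding e_def kernel_term_def 1 2 3 qpow_add by (simp only: mult_ac)
  qed
  ultimately have "((\<lambda>(R, l). sg2 (R + 1) (l - 1) * e R l) has_sum x * qpow \<tau> (of_int N) * S) UNIV"
    by simp
  from has_sum_add [OF S has_sum_uminusI [OF this]]
  have "((\<lambda>(R, l). (sg2 R l - sg2 (R + 1) (l - 1)) * e R l)
      has_sum (S - x * qpow \<tau> (of_int N) * S)) UNIV"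
    by (simp add: case_prod_unfold left_diff_distrib)
  then have 1: "((\<lambda>(R, l). ((if l = 0 then 1 else 0) - (if R = -1 then 1 else 0)) * e R l)
      has_sum (S - x * qpow \<tau> (of_int N) * S)) UNIV"
    unfolding sg2_diff_anti .
  \<comment> \<open>Replacing \<open>R\<close> by \<open>- R\<close> identifies the line
    \<open>l = 0\<close> with the triple product.\<close>
  have "((\<lambda>R. e R 0) has_sum Theta x (qpow \<tau> 1)) UNIV"
  proof -
    have "bij (\<lambda>k :: int. - k)" by (rule involuntory_imp_bij) simp
    then have "((\<lambda>R. (-1) powi (- R) * qpow \<tau> (of_int ((- R) * (- R - 1)) / 2) * x powi (- R))
        has_sum Theta x (qpow \<tau> 1)) UNIV"
      using jacobi_triple_product [OF \<tau> x]
        has_sum_reindex_bij_betw [where f = "\<lambda>k. (-1) powi k * qpow \<tau> (of_int (k * (k - 1)) / 2) * x powi k"]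
      by blast
    moreover have "(-1) powi (- R) * qpow \<tau> (of_int ((- R) * (- R - 1)) / 2) * x powi (- R) = e R 0" for R
    proof -
      have "(- R) * (- R - 1) = R * (R + 1)" by (simp add: algebra_simps)
      moreover have "(-1 :: complex) powi (- R) = (-1) powi R" by (rule minus_one_powi_cong) simp
      ultimately show ?thesis by (simp only: e_def kernel_term_def) simp
    qed
    ultimately show ?thesis by simp
  qed
  then have 2: "((\<lambda>(R, l). if l = 0 then e R l else 0) has_sum Theta x (qpow \<tau> 1)) UNIV"
    by (intro has_sum_inj_support [where h = "\<lambda>R. (R, 0)" and B = UNIV]) (auto simp: inj_on_def)
  \<comment> \<open>On the line \<open>R = -1\<close> the power of \<open>x\<close> is constant,
    which leaves a theta series at an integral power of \<open>q\<close>, and that is 0.\<close>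
  have "((\<lambda>l. (- x) * ((-1) powi l * qpow \<tau> (of_int (l * (l - 1)) / 2 + of_int N * of_int l)))
      has_sum (- x) * 0) UNIV"
    by (intro has_sum_cmult_right alternating_line_sum_zero \<tau>)
  moreover have "(- x) * ((-1) powi l * qpow \<tau> (of_int (l * (l - 1)) / 2 + of_int N * of_int l)) = e (-1) l"
    for l
  proof -
    have "(-1 + l) * (-1 + l + 1) = l * (l - 1)" by (simp add: algebra_simps)
    moreover have "(-1 :: complex) powi (-1 + l) = - ((-1) powi l)" by (rule minus_one_powi_opp) simp
    ultimately show ?thesis by (simp only: e_def kernel_term_def) simp
  qed
  ultimately have "((\<lambda>l. e (-1) l) has_sum 0) UNIV"
    by simp
  then have 3: "((\<lambda>(R, l). if R = -1 then e R l else 0) has_sum 0) UNIV"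
    by (intro has_sum_inj_support [where h = "\<lambda>l. (-1, l)" and B = UNIV]) (auto simp: inj_on_def)
  have "((\<lambda>(R, l). ((if l = 0 then 1 else 0) - (if R = -1 then 1 else 0)) * e R l)
      has_sum (Theta x (qpow \<tau> 1) + - 0)) UNIV"
    using has_sum_add [OF 2 has_sum_uminusI [OF 3]]
    by (rule back_subst [of "\<lambda>f. (f has_sum _) _"]) (auto simp: fun_eq_iff)
  with 1 have "S - x * qpow \<tau> (of_int N) * S = Theta x (qpow \<tau> 1)"
    using has_sum_unique by force
  then show ?thesis
    by (simp add: S_def algebra_simps)
qed

subsection \<open>Quasi-periodicity of the double theta series\<close>

definition opposite_parity :: "(int \<times> int) set" where
  "opposite_parity = {(r, s). \<not> [r = s] (mod 2)}"

definition theta_exp :: "int \<Rightarrow> int \<Rightarrow> int \<Rightarrow> int \<Rightarrow> int \<Rightarrow> real" where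
  "theta_exp t p m r s =
    1/8 * of_int r ^ 2 + (4 * of_int t - 1) / 4 * of_int r * of_int s + 1/8 * of_int s ^ 2
      + of_int (p + m) / 2 * of_int r + of_int (p - m) / 2 * of_int s"

definition theta_term :: "complex \<Rightarrow> int \<Rightarrow> int \<Rightarrow> int \<Rightarrow> int \<Rightarrow> int \<Rightarrow> complex" where
  "theta_term \<tau> t p m r s = (-1) powi ((r - s - 1) div 2) * qpow \<tau> (theta_exp t p m r s)"

lemma theta_conv_term:
  "theta \<tau> t p m = (\<Sum>\<^sub>\<infinity>(r, s)\<in>opposite_parity. sg2 r s * theta_term \<tau> t p m r s)"
  by (simp add: theta_def theta_term_def theta_exp_def opposite_parity_def mult.assoc)

lemma opposite_parity_iff: "(r, s) \<in> opposite_parity \<longleftrightarrow> odd (r - s)"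
  by (simp add: opposite_parity_def cong_iff_dvd_diff)

text \<open>The diagonal shift preserves \<open>r - s\<close> and with it the sign, while the
  quadratic form produces the linear terms \<open>t * (r + s)\<close>, which raise \<open>p\<close>
  by \<open>2 * t\<close>.\<close>

lemma theta_term_shift:
  "theta_term \<tau> t p m (r + 1) (s + 1) = qpow \<tau> (of_int (t + p)) * theta_term \<tau> t (p + 2 * t) m r s"
proof -
  have "theta_exp t p m (r + 1) (s + 1) = of_int (t + p) + theta_exp t (p + 2 * t) m r s"
    by (simp add: theta_exp_def field_simps power2_eq_square)
  then show ?thesis
    by (simp add: theta_term_def qpow_add)
qed

text \<open>Parity forces \<open>s = 2 * k\<close> on this line, and up to a constant the exponent
  becomes \<open>k * (k - 1) / 2 + N * k\<close> with integral \<open>N\<close>, so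
  \<open>alternating_line_sum_zero\<close> applies.\<close>

lemma theta_boundary_row:
  assumes "Im \<tau> > 0"
  shows "((\<lambda>(r, s). if r = -1 then theta_term \<tau> t p m r s else 0) has_sum 0) opposite_parity"
proof (rule has_sum_inj_support [where h = "\<lambda>k. (-1, 2 * k)" and B = UNIV])
  define c where "c = - qpow \<tau> (1 / 8 - of_int (p + m) / 2)"
  have "((\<lambda>k. c * ((-1) powi k * qpow \<tau> (of_int (k * (k - 1)) / 2 + of_int (1 - 2 * t + p - m) * of_int k)))
      has_sum c * 0) UNIV"
    by (intro has_sum_cmult_right alternating_line_sum_zero assms)
  moreover have "c * ((-1) powi k * qpow \<tau> (of_int (k * (k - 1)) / 2 + of_int (1 - 2 * t + p - m) * of_int k))
      = theta_term \<tau> t p m (-1) (2 * k)" for k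
  proof -
    have 1: "theta_exp t p m (-1) (2 * k) = (1 / 8 - of_int (p + m) / 2)
        + (of_int (k * (k - 1)) / 2 + of_int (1 - 2 * t + p - m) * of_int k)"
      by (simp add: theta_exp_def field_simps power2_eq_square)
    have "(- 1 - 2 * k - 1) div 2 = - 1 - k" by simp
    then have "(-1 :: complex) powi ((- 1 - 2 * k - 1) div 2) = - ((-1) powi k)"
      using minus_one_powi_opp [of "- 1 - k" k] by simp
    with 1 show ?thesis by (simp add: theta_term_def c_def qpow_add)
  qed
  ultimately show "((\<lambda>k. case (-1, 2 * k) of (r, s) \<Rightarrow> if r = -1 then theta_term \<tau> t p m r s else 0)
      has_sum 0) UNIV"
    by simp
next
  fix y assume y: "y \<in> opposite_parity - range (\<lambda>k. (-1, 2 * k))"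
  obtain r s where [simp]: "y = (r, s)" by (cases y)
  have "r \<noteq> -1"
  proof
    assume "r = -1"
    with y have "y = (\<lambda>k. (-1, 2 * k)) (s div 2)"
      by (auto simp: opposite_parity_iff)
    with y show False by blast
  qed
  then show "(case y of (r, s) \<Rightarrow> if r = -1 then theta_term \<tau> t p m r s else 0) = 0"
    by simp
qed (auto simp: inj_on_def opposite_parity_iff)

text \<open>The row argument with \<open>- m\<close> for \<open>m\<close>. The constant
  \<open>c\<close> has no minus sign here because \<open>(2 * k + 1 - 1) div 2\<close> is
  \<open>k\<close>.\<close>

lemma theta_boundary_column:
  assumes "Im \<tau> > 0"
  shows "((\<lambda>(r, s). if s = -1 then theta_term \<tau> t p m r s else 0) has_sum 0) opposite_parity"
proof (rule has_sum_inj_support [where h = "\<lambda>k. (2 * k, -1)" and B = UNIV])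
  define c where "c = qpow \<tau> (1 / 8 - of_int (p - m) / 2)"
  have "((\<lambda>k. c * ((-1) powi k * qpow \<tau> (of_int (k * (k - 1)) / 2 + of_int (1 - 2 * t + p + m) * of_int k)))
      has_sum c * 0) UNIV"
    by (intro has_sum_cmult_right alternating_line_sum_zero assms)
  moreover have "c * ((-1) powi k * qpow \<tau> (of_int (k * (k - 1)) / 2 + of_int (1 - 2 * t + p + m) * of_int k))
      = theta_term \<tau> t p m (2 * k) (-1)" for k
  proof -
    have "theta_exp t p m (2 * k) (-1) = (1 / 8 - of_int (p - m) / 2)
        + (of_int (k * (k - 1)) / 2 + of_int (1 - 2 * t + p + m) * of_int k)"
      by (simp add: theta_exp_def field_simps power2_eq_square)
    then show ?thesis by (simp add: theta_term_def c_def qpow_add)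
  qed
  ultimately show "((\<lambda>k. case (2 * k, -1) of (r, s) \<Rightarrow> if s = -1 then theta_term \<tau> t p m r s else 0)
      has_sum 0) UNIV"
    by simp
next
  fix y assume y: "y \<in> opposite_parity - range (\<lambda>k. (2 * k, -1))"
  obtain r s where [simp]: "y = (r, s)" by (cases y)
  have "s \<noteq> -1"
  proof
    assume "s = -1"
    with y have "y = (\<lambda>k. (2 * k, -1)) (r div 2)"
      by (auto simp: opposite_parity_iff)
    with y show False by blast
  qed
  then show "(case y of (r, s) \<Rightarrow> if s = -1 then theta_term \<tau> t p m r s else 0) = 0"
    by simp
qed (auto simp: inj_on_def opposite_parity_iff)

text \<open>Reindexing by the diagonal shift changes \<open>sg2\<close> only on the lines
  \<open>r = -1\<close> and \<open>s = -1\<close>, whose contributions are 0 by the two boundary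
  lemmas.\<close>

lemma theta_shift:
  assumes \<tau>: "Im \<tau> > 0"
    and sum: "\<And>p. (\<lambda>(r, s). sg2 r s * theta_term \<tau> t p m r s) summable_on opposite_parity"
  shows "theta \<tau> t p m = qpow \<tau> (of_int (t + p)) * theta \<tau> t (p + 2 * t) m"
proof -
  define c where "c = qpow \<tau> (of_int (t + p))"
  have has: "((\<lambda>(r, s). sg2 r s * theta_term \<tau> t p m r s) has_sum theta \<tau> t p m) opposite_parity" for p
    unfolding theta_conv_term using sum by (rule has_sum_infsum)
  have "bij_betw (\<lambda>(r :: int, s :: int). (r + 1, s + 1)) opposite_parity opposite_parity"
    by (rule bij_betw_byWitness [where f' = "\<lambda>(r, s). (r - 1, s - 1)"]) (auto simp: opposite_parity_iff)
  from has_sum_reindex_bij_betw [OF this, of "\<lambda>(r, s). sg2 r s * theta_term \<tau> t p m r s" "theta \<tau> t p m"]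
    has [of p]
  have 1: "((\<lambda>(r, s). sg2 (r + 1) (s + 1) * (c * theta_term \<tau> t (p + 2 * t) m r s))
      has_sum theta \<tau> t p m) opposite_parity"
    by (simp add: case_prod_unfold theta_term_shift c_def)
  have "((\<lambda>(r, s). c * (sg2 r s * theta_term \<tau> t (p + 2 * t) m r s)
          + c * ((if r = -1 then theta_term \<tau> t (p + 2 * t) m r s else 0)
                 + (if s = -1 then theta_term \<tau> t (p + 2 * t) m r s else 0)))
      has_sum (c * theta \<tau> t (p + 2 * t) m + c * (0 + 0))) opposite_parity"
    using has_sum_add [OF has_sum_cmult_right [OF has [of "p + 2 * t"], of c]
        has_sum_cmult_right [OF has_sum_add [OF theta_boundary_row [OF \<tau>] theta_boundary_column [OF \<tau>]], of c]]
    by (simp only: case_prod_unfold)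
  moreover have "c * (sg2 r s * y) + c * ((if r = -1 then y else 0) + (if s = -1 then y else 0))
      = sg2 (r + 1) (s + 1) * (c * y)" for r s y
  proof -
    have "sg2 (r + 1) (s + 1) = sg2 r s + ((if r = -1 then 1 else 0) + (if s = -1 then 1 else 0))"
      using sg2_diff_diag [of r s] by (simp add: diff_eq_eq add.commute)
    then show ?thesis by (auto simp: algebra_simps)
  qed
  ultimately have "((\<lambda>(r, s). sg2 (r + 1) (s + 1) * (c * theta_term \<tau> t (p + 2 * t) m r s))
      has_sum (c * theta \<tau> t (p + 2 * t) m)) opposite_parity"
    by simp
  with 1 show ?thesis
    unfolding c_def using has_sum_unique by blast
qed

subsection \<open>Absolute convergence of the fourfold series\<close>

text \<open>The exponent of \<open>q\<close> in a term of the fourfold series, taken over the reals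
  so that it can be estimated as a quadratic polynomial.\<close>

definition joint_exp :: "real \<Rightarrow> real \<Rightarrow> real \<Rightarrow> real \<Rightarrow> real \<Rightarrow> real \<Rightarrow> real" where
  "joint_exp t m r s R l =
    1/8 * r\<^sup>2 + (4 * t - 1) / 4 * r * s + 1/8 * s\<^sup>2 + (t + m) / 2 * r + (t - m) / 2 * s
      + (R + l) * (R + l + 1) / 2 + l * (r + s + 1) / 2"

lemma quadratic_minus_linear_ge:
  fixes a b y :: real
  assumes "a > 0"
  shows "a * y\<^sup>2 - b * y \<ge> - (b\<^sup>2 / (4 * a))"
proof -
  have "a * y\<^sup>2 - b * y + b\<^sup>2 / (4 * a) = a * (y - b / (2 * a))\<^sup>2"
    using assms by (simp add: field_simps power2_eq_square)
  also have "\<dots> \<ge> 0" using assms by simp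
  finally show ?thesis by simp
qed

text \<open>One half of the square yields linear growth in \<open>l\<close> at the cost of
  \<open>v / 4\<close>. The other half together with \<open>R * v\<close> yields growth in
  \<open>R\<close>: either \<open>v\<close> is at most \<open>R / 2\<close> and the square is large,
  or \<open>R * v\<close> is.\<close>

lemma mixed_quadratic_ge:
  fixes R l d v :: real
  assumes "R \<ge> 0" "l \<ge> 0" "d \<ge> 0" "v \<ge> 0"
  shows "(R + l + d - v)\<^sup>2 / 2 + R * v \<ge> R\<^sup>2 / 16 + l / 4 - v / 4 - 1"
proof -
  define u where "u = R + l + d - v"
  have "(u - 1/2)\<^sup>2 = u\<^sup>2 - u + 1/4" by (simp add: power2_eq_square algebra_simps)
  then have "u\<^sup>2 \<ge> u - 1/4" using zero_le_power2 [of "u - 1/2"] by linarith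
  then have 1: "u\<^sup>2 / 4 \<ge> (l - v) / 4 - 1"
    using assms u_def unfolding add_divide_distrib diff_divide_distrib by linarith
  have 2: "u\<^sup>2 / 4 + R * v \<ge> R\<^sup>2 / 16"
  proof (cases "v \<le> R / 2")
    case True
    then have "(R / 2)\<^sup>2 \<le> u\<^sup>2"
      using assms by (intro power_mono) (auto simp: u_def)
    then have "R\<^sup>2 / 16 \<le> u\<^sup>2 / 4" by (simp add: power_divide)
    moreover have "R * v \<ge> 0" using assms by simp
    ultimately show ?thesis by linarith
  next
    case False
    then have "R * (R / 2) \<le> R * v"
      using assms by (intro mult_left_mono) auto
    then have "R\<^sup>2 / 2 \<le> R * v" by (simp add: power2_eq_square)
    then show ?thesis using zero_le_power2 [of u] zero_le_power2 [of R] by linarith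
  qed
  from 1 2 show ?thesis unfolding u_def [symmetric] by (simp add: field_simps)
qed

text \<open>All mixed terms are nonnegative in this case; the linear term in \<open>R\<close>, whose
  coefficient may have either sign, is absorbed by half the square of \<open>R\<close>.\<close>

lemma joint_exp_ge_pos_pos:
  fixes t m r s R l c :: real
  assumes "t \<ge> 2" "1 \<le> m" "m \<le> t - 1" "r \<ge> 0" "s \<ge> 0" "R \<ge> 0" "l \<ge> 0"
  shows "joint_exp t m r s R l + c * R \<ge> (\<bar>r\<bar> + \<bar>s\<bar> + \<bar>R\<bar> + \<bar>l\<bar>) / 4 - (1/4 - c)\<^sup>2 / 2"
proof -
  have "joint_exp t m r s R l + c * R - (r + s + R + l) / 4 + (1/4 - c)\<^sup>2 / 2
     = (1/2 * R\<^sup>2 - (1/4 - c) * R + (1/4 - c)\<^sup>2 / 2) + 1/8 * r\<^sup>2 + 1/8 * s\<^sup>2 + (t - 1/4) * (r * s)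
        + ((t + m) / 2 - 1/4) * r + ((t - m) / 2 - 1/4) * s + R * l + l\<^sup>2 / 2 + R / 2 + 3/4 * l + l * r / 2 + l * s / 2"
    by (simp add: joint_exp_def field_simps power2_eq_square)
  moreover have "1/2 * R\<^sup>2 - (1/4 - c) * R + (1/4 - c)\<^sup>2 / 2 \<ge> 0"
    using quadratic_minus_linear_ge [of "1/2" "1/4 - c" R] by simp
  moreover have "(t - 1/4) * (r * s) \<ge> 0" "((t + m) / 2 - 1/4) * r \<ge> 0" "((t - m) / 2 - 1/4) * s \<ge> 0"
    "R * l \<ge> 0" "l * r \<ge> 0" "l * s \<ge> 0"
    using assms by simp_all
  moreover have "r\<^sup>2 \<ge> 0" "s\<^sup>2 \<ge> 0" "l\<^sup>2 \<ge> 0"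
    by simp_all
  ultimately have "joint_exp t m r s R l + c * R - (r + s + R + l) / 4 + (1/4 - c)\<^sup>2 / 2 \<ge> 0"
    using assms by linarith
  then show ?thesis using assms by simp
qed

text \<open>After negating all variables the mixed terms are again nonnegative, and the squares of
  \<open>a\<close>, \<open>b\<close> and \<open>A\<close> absorb their own linear terms.\<close>

lemma joint_exp_ge_neg_neg:
  fixes t m r s R l c :: real
  assumes "t \<ge> 2" "1 \<le> m" "m \<le> t - 1" "r \<le> -1" "s \<le> -1" "R \<le> -1" "l \<le> -1"
  shows "joint_exp t m r s R l + c * R \<ge> (\<bar>r\<bar> + \<bar>s\<bar> + \<bar>R\<bar> + \<bar>l\<bar>) / 4
    - (2 * ((t + m) / 2 + 1/4)\<^sup>2 + 2 * ((t - m) / 2 + 1/4)\<^sup>2 + (c + 3/4)\<^sup>2 / 2)"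
proof -
  define a b A B where "a = - r" "b = - s" "A = - R" "B = - l"
  note defs = this
  define C1 C2 C3 where "C1 = ((t + m) / 2 + 1/4)\<^sup>2" "C2 = ((t - m) / 2 + 1/4)\<^sup>2" "C3 = (c + 3/4)\<^sup>2"
  note C = this
  have ab: "a \<ge> 1" "b \<ge> 1" "A \<ge> 1" "B \<ge> 1" using assms by (simp_all add: defs)
  have rs: "r = - a" "s = - b" "R = - A" "l = - B" by (simp_all add: defs)
  have "joint_exp t m r s R l + c * R - (a + b + A + B) / 4
     = (1/8 * a\<^sup>2 - ((t + m) / 2 + 1/4) * a) + (1/8 * b\<^sup>2 - ((t - m) / 2 + 1/4) * b)
       + (1/2 * A\<^sup>2 - (c + 3/4) * A) + (t - 1/4) * (a * b) + (A - 1) * B + B\<^sup>2 / 2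
       + B * (a + b - 1/2) / 2"
    unfolding rs by (simp add: joint_exp_def field_simps power2_eq_square)
  moreover have "1/8 * a\<^sup>2 - ((t + m) / 2 + 1/4) * a \<ge> - (2 * C1)"
    unfolding C using quadratic_minus_linear_ge [of "1/8" "(t + m) / 2 + 1/4" a] by simp
  moreover have "1/8 * b\<^sup>2 - ((t - m) / 2 + 1/4) * b \<ge> - (2 * C2)"
    unfolding C using quadratic_minus_linear_ge [of "1/8" "(t - m) / 2 + 1/4" b] by simp
  moreover have "1/2 * A\<^sup>2 - (c + 3/4) * A \<ge> - (C3 / 2)"
    unfolding C using quadratic_minus_linear_ge [of "1/2" "c + 3/4" A] by simp
  moreover have "(t - 1/4) * (a * b) \<ge> 0" "(A - 1) * B \<ge> 0" "B\<^sup>2 \<ge> 0" "B * (a + b - 1/2) \<ge> 0"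
    using assms(1) ab by simp_all
  ultimately have "joint_exp t m r s R l + c * R - (a + b + A + B) / 4 \<ge>
      - (2 * C1) - (2 * C2) - (C3 / 2)"
    by linarith
  moreover have "\<bar>r\<bar> + \<bar>s\<bar> + \<bar>R\<bar> + \<bar>l\<bar> = a + b + A + B" using ab by (simp add: rs)
  ultimately show ?thesis unfolding C [symmetric] by simp
qed

text \<open>The coupling \<open>l * (r + s + 1) / 2\<close> is now nonpositive. It is combined with
  squares from both quadratic forms into \<open>X\<close>, and \<open>mixed_quadratic_ge\<close>
  applies. The coefficients of \<open>\<alpha>\<close> and \<open>\<beta>\<close> are at least 1/2,
  which pays for the lost \<open>v / 4\<close>.\<close>

lemma joint_exp_ge_neg_pos:
  fixes t m r s R l c :: real
  assumes "t \<ge> 2" "1 \<le> m" "m \<le> t - 1" "r \<le> -1" "s \<le> -1" "R \<ge> 0" "l \<ge> 0"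
  shows "joint_exp t m r s R l + c * R \<ge> (\<bar>r\<bar> + \<bar>s\<bar> + \<bar>R\<bar> + \<bar>l\<bar>) / 4 - (4 * (1/4 - c)\<^sup>2 + 3/2)"
proof -
  define \<alpha> \<beta> v where "\<alpha> = - 1 - r" "\<beta> = - 1 - s" "v = (\<alpha> + \<beta>) / 2"
  note defs = this
  define X C where "X = (R + l + 0 - v)\<^sup>2 / 2 + R * v" "C = (1/4 - c)\<^sup>2"
  note XC = this
  have nonneg: "\<alpha> \<ge> 0" "\<beta> \<ge> 0" "v \<ge> 0" using assms by (simp_all add: defs)
  have rs: "r = - 1 - \<alpha>" "s = - 1 - \<beta>" by (simp_all add: defs)
  have "joint_exp t m r s R l + c * R
     = X + R / 2 + (t - m) / 2 * \<alpha> + (t + m) / 2 * \<beta>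
        + (t - 1/2) * (\<alpha> * \<beta>) + c * R"
    unfolding rs XC defs(3) by (simp add: joint_exp_def field_simps power2_eq_square)
  moreover have "X \<ge> R\<^sup>2 / 16 + l / 4 - v / 4 - 1"
    unfolding XC using assms nonneg by (intro mixed_quadratic_ge) auto
  moreover have "1/16 * R\<^sup>2 - (1/4 - c) * R \<ge> - (4 * C)"
    unfolding XC using quadratic_minus_linear_ge [of "1/16" "1/4 - c" R] by simp
  moreover have "(1/4 - c) * R = R / 4 - c * R"
    by (simp add: left_diff_distrib)
  moreover have "(t - 1/2) * (\<alpha> * \<beta>) \<ge> 0"
    using assms nonneg by simp
  moreover have "(t - m) / 2 * \<alpha> \<ge> 1/2 * \<alpha>" "(t + m) / 2 * \<beta> \<ge> 1/2 * \<beta>"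
    using assms nonneg by (intro mult_right_mono; simp)+
  moreover have "v = \<alpha> / 2 + \<beta> / 2" by (simp add: defs(3))
  ultimately have "joint_exp t m r s R l + c * R \<ge> (2 + \<alpha> + \<beta> + R + l) / 4 - (4 * C + 3/2)"
    using assms(6) nonneg unfolding add_divide_distrib diff_divide_distrib by linarith
  moreover have "\<bar>r\<bar> + \<bar>s\<bar> + \<bar>R\<bar> + \<bar>l\<bar> = 2 + \<alpha> + \<beta> + R + l"
    using nonneg assms by (simp add: rs)
  ultimately show ?thesis unfolding XC by simp
qed

text \<open>The same argument with the reflection applied to \<open>(R, l)\<close>. It turns
  \<open>c * R\<close> into \<open>- c * \<rho> - c\<close>, whence the absolute value of
  \<open>c\<close> in the constant.\<close>

lemma joint_exp_ge_pos_neg: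
  fixes t m r s R l c :: real
  assumes "t \<ge> 2" "1 \<le> m" "m \<le> t - 1" "r \<ge> 0" "s \<ge> 0" "R \<le> -1" "l \<le> -1"
  shows "joint_exp t m r s R l + c * R \<ge> (\<bar>r\<bar> + \<bar>s\<bar> + \<bar>R\<bar> + \<bar>l\<bar>) / 4 - (4 * (1/4 + c)\<^sup>2 + 3/2 + \<bar>c\<bar>)"
proof -
  define \<rho> \<sigma> v where "\<rho> = - 1 - R" "\<sigma> = - 1 - l" "v = (r + s) / 2"
  note defs = this
  define X C where "X = (\<rho> + \<sigma> + 1 - v)\<^sup>2 / 2 + \<rho> * v" "C = (1/4 + c)\<^sup>2"
  note XC = this
  have nonneg: "\<rho> \<ge> 0" "\<sigma> \<ge> 0" "v \<ge> 0" using assms by (simp_all add: defs)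
  have Rl: "R = - 1 - \<rho>" "l = - 1 - \<sigma>" by (simp_all add: defs)
  have "joint_exp t m r s R l + c * R
     = X + \<rho> / 2 + (t + m) / 2 * r + (t - m) / 2 * s
        + (t - 1/2) * (r * s) - c * \<rho> - c"
    unfolding Rl XC defs(3) by (simp add: joint_exp_def field_simps power2_eq_square)
  moreover have "X \<ge> \<rho>\<^sup>2 / 16 + \<sigma> / 4 - v / 4 - 1"
    unfolding XC using assms nonneg by (intro mixed_quadratic_ge) auto
  moreover have "1/16 * \<rho>\<^sup>2 - (1/4 + c) * \<rho> \<ge> - (4 * C)"
    unfolding XC using quadratic_minus_linear_ge [of "1/16" "1/4 + c" \<rho>] by simp
  moreover have "(1/4 + c) * \<rho> = \<rho> / 4 + c * \<rho>"
    by (simp add: distrib_right)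
  moreover have "(t - 1/2) * (r * s) \<ge> 0"
    using assms by simp
  moreover have "(t + m) / 2 * r \<ge> 1/2 * r" "(t - m) / 2 * s \<ge> 1/2 * s"
    using assms nonneg by (intro mult_right_mono; simp)+
  moreover have "v = r / 2 + s / 2" by (simp add: defs(3))
  moreover have "c \<le> \<bar>c\<bar>" by simp
  ultimately have "joint_exp t m r s R l + c * R \<ge> (2 + r + s + \<rho> + \<sigma>) / 4
      - (4 * C + 3/2 + \<bar>c\<bar>)"
    using assms(4,5) nonneg unfolding add_divide_distrib diff_divide_distrib by linarith
  moreover have "\<bar>r\<bar> + \<bar>s\<bar> + \<bar>R\<bar> + \<bar>l\<bar> = 2 + r + s + \<rho> + \<sigma>"
    using nonneg assms by (simp add: Rl)
  ultimately show ?thesis unfolding XC by simp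
qed

text \<open>The quadratic form is indefinite, but nonzero signs confine each pair to entries that
  are both nonnegative or both at most -1. The constants of the four cases are nonnegative, so their
  sum serves for all.\<close>

lemma joint_exp_lower_bound:
  fixes t m :: int and c :: real
  assumes "t \<ge> 2" "1 \<le> m" "m < t"
  obtains K where "\<And>r s R l :: int. sg2 r s \<noteq> 0 \<Longrightarrow> sg2 R l \<noteq> 0 \<Longrightarrow>
    joint_exp t m r s R l + c * R \<ge> (\<bar>of_int r\<bar> + \<bar>of_int s\<bar> + \<bar>of_int R\<bar> + \<bar>of_int l\<bar>) / 4 - K"
proof -
  define T M where "T = real_of_int t" "M = real_of_int m"
  note TM = this
  have TM': "T \<ge> 2" "1 \<le> M" "M \<le> T - 1" using assms by (simp_all add: TM)
  define K1 K2 K3 K4 where "K1 = (1/4 - c)\<^sup>2 / 2"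
    "K2 = 2 * ((T + M) / 2 + 1/4)\<^sup>2 + 2 * ((T - M) / 2 + 1/4)\<^sup>2 + (c + 3/4)\<^sup>2 / 2"
    "K3 = 4 * (1/4 - c)\<^sup>2 + 3/2" "K4 = 4 * (1/4 + c)\<^sup>2 + 3/2 + \<bar>c\<bar>"
  note K = this
  have K0: "K1 \<ge> 0" "K2 \<ge> 0" "K3 \<ge> 0" "K4 \<ge> 0" by (simp_all add: K)
  show ?thesis
  proof (rule that [of "K1 + K2 + K3 + K4"], fold TM)
    fix r s R l :: int
    assume "sg2 r s \<noteq> 0" "sg2 R l \<noteq> 0"
    then have "(r \<ge> 0 \<and> s \<ge> 0 \<or> r \<le> -1 \<and> s \<le> -1) \<and> (R \<ge> 0 \<and> l \<ge> 0 \<or> R \<le> -1 \<and> l \<le> -1)"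
      by (auto simp: sg2_def sg_def split: if_splits)
    moreover have "real_of_int n \<le> -1 \<longleftrightarrow> n \<le> -1" for n
      by linarith
    ultimately have "(real_of_int r \<ge> 0 \<and> real_of_int s \<ge> 0 \<or> real_of_int r \<le> -1 \<and> real_of_int s \<le> -1)
        \<and> (real_of_int R \<ge> 0 \<and> real_of_int l \<ge> 0 \<or> real_of_int R \<le> -1 \<and> real_of_int l \<le> -1)"
      by simp
    then consider "real_of_int r \<ge> 0" "real_of_int s \<ge> 0" "real_of_int R \<ge> 0" "real_of_int l \<ge> 0"
      | "real_of_int r \<le> -1" "real_of_int s \<le> -1" "real_of_int R \<le> -1" "real_of_int l \<le> -1"
      | "real_of_int r \<le> -1" "real_of_int s \<le> -1" "real_of_int R \<ge> 0" "real_of_int l \<ge> 0"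
      | "real_of_int r \<ge> 0" "real_of_int s \<ge> 0" "real_of_int R \<le> -1" "real_of_int l \<le> -1"
      by blast
    then show "joint_exp T M r s R l + c * R \<ge>
        (\<bar>of_int r\<bar> + \<bar>of_int s\<bar> + \<bar>of_int R\<bar> + \<bar>of_int l\<bar>) / 4 - (K1 + K2 + K3 + K4)"
    proof cases
      case 1
      from joint_exp_ge_pos_pos [OF TM' this, of c] K0 show ?thesis unfolding K by linarith
    next
      case 2
      from joint_exp_ge_neg_neg [OF TM' this, of c] K0 show ?thesis unfolding K by linarith
    next
      case 3
      from joint_exp_ge_neg_pos [OF TM' this, of c] K0 show ?thesis unfolding K by linarith
    next
      case 4
      from joint_exp_ge_pos_neg [OF TM' this, of c] K0 show ?thesis unfolding K by linarith
    qed
  qed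
qed

lemma norm_sg2_le: "norm (sg2 r s) \<le> 1"
  by (simp add: sg2_def sg_def)

text \<open>For indices of opposite parity, \<open>(r + s + 1) div 2\<close> is the exponent of \<open>q\<close> in the denominator of \<open>g\<close>.\<close>

definition joint_term :: "complex \<Rightarrow> int \<Rightarrow> int \<Rightarrow> complex \<Rightarrow> int \<times> int \<Rightarrow> int \<times> int \<Rightarrow> complex" where
  "joint_term \<tau> t m x = (\<lambda>(r, s) (R, l).
    sg2 r s * theta_term \<tau> t t m r s * (sg2 R l * kernel_term \<tau> x ((r + s + 1) div 2) R l))"

lemma of_int_half_sum:
  assumes "odd (r - s)"
  shows "real_of_int ((r + s + 1) div 2) = of_int (r + s + 1) / 2"
proof -
  have "even (r + s + 1)" using assms by presburger
  then obtain N where N: "r + s + 1 = 2 * N" by (rule evenE)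
  show ?thesis unfolding N by simp
qed

text \<open>With \<open>c = ln (norm x) / \<kappa>\<close> the power of \<open>x\<close> is absorbed
  into the exponent as \<open>c * R\<close>. Linear growth of the exponent then bounds the norm by a
  product of four two-sided geometric series.\<close>

lemma joint_summable:
  assumes \<tau>: "Im \<tau> > 0" and t: "t \<ge> 2" "1 \<le> m" "m < t" and x: "x \<noteq> 0"
  shows "(\<lambda>(p, k). joint_term \<tau> t m x p k) summable_on opposite_parity \<times> UNIV"
proof -
  define \<kappa> where "\<kappa> = 2 * pi * Im \<tau>"
  have \<kappa>: "\<kappa> > 0" using \<tau> by (simp add: \<kappa>_def)
  define c where "c = ln (norm x) / \<kappa>"
  obtain K where K: "\<And>r s R l :: int. sg2 r s \<noteq> 0 \<Longrightarrow> sg2 R l \<noteq> 0 \<Longrightarrow>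
      joint_exp t m r s R l + c * R \<ge> (\<bar>of_int r\<bar> + \<bar>of_int s\<bar> + \<bar>of_int R\<bar> + \<bar>of_int l\<bar>) / 4 - K"
    using joint_exp_lower_bound [OF t] by metis
  define h where "h n = exp (- (\<kappa> / 4) * \<bar>of_int n\<bar>)" for n :: int
  have h: "h summable_on UNIV"
    unfolding h_def [abs_def] using \<kappa> by (intro summable_on_exp_abs_int) simp
  have h0: "h n \<ge> 0" for n by (simp add: h_def)
  have h2: "(\<lambda>(n, k). h n * h k) summable_on (UNIV \<times> UNIV)"
    by (rule summable_on_Times_mult) (use h h0 in auto)
  have "(\<lambda>(p, k). (case p of (r, s) \<Rightarrow> h r * h s) * (case k of (R, l) \<Rightarrow> h R * h l))
      summable_on (UNIV \<times> UNIV) \<times> (UNIV \<times> UNIV)"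
    by (rule summable_on_Times_mult) (use h2 h0 in auto)
  then have dom: "(\<lambda>y. exp (\<kappa> * K) * (case y of (p, k) \<Rightarrow>
      (case p of (r, s) \<Rightarrow> h r * h s) * (case k of (R, l) \<Rightarrow> h R * h l))) summable_on opposite_parity \<times> UNIV"
    by (intro summable_on_cmult_right) (auto intro: summable_on_subset)
  have bound: "norm (joint_term \<tau> t m x (r, s) (R, l)) \<le> exp (\<kappa> * K) * (h r * h s * (h R * h l))"
    if "(r, s) \<in> opposite_parity" for r s R l
  proof (cases "sg2 r s = 0 \<or> sg2 R l = 0")
    case True
    then show ?thesis by (auto simp: joint_term_def h0)
  next
    case False
    define N where "N = (r + s + 1) div 2"
    have N: "real_of_int N = of_int (r + s + 1) / 2"
      unfolding N_def using that by (intro of_int_half_sum) (simp add: opposite_parity_iff)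
    have n1: "norm (theta_term \<tau> t t m r s) = exp (- \<kappa> * theta_exp t t m r s)"
      by (simp add: theta_term_def norm_mult norm_qpow \<kappa>_def)
    have n2: "norm (kernel_term \<tau> x N R l) =
        exp (- \<kappa> * (of_int ((R + l) * (R + l + 1)) / 2 + of_int N * of_int l)) * exp (- (of_int R * ln (norm x)))"
      using x by (simp add: kernel_term_def norm_mult norm_qpow norm_powi_exp \<kappa>_def)
    have "norm (joint_term \<tau> t m x (r, s) (R, l)) =
        norm (sg2 r s) * norm (sg2 R l) * exp (- \<kappa> * theta_exp t t m r s
          + - \<kappa> * (of_int ((R + l) * (R + l + 1)) / 2 + of_int N * of_int l) + - (of_int R * ln (norm x)))"
      unfolding joint_term_def prod.case N_def [symmetric] norm_mult n1 n2 exp_add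
      by (simp only: mult_ac)
    also have "- \<kappa> * theta_exp t t m r s
          + - \<kappa> * (of_int ((R + l) * (R + l + 1)) / 2 + of_int N * of_int l) + - (of_int R * ln (norm x))
        = - \<kappa> * (joint_exp t m r s R l + c * R)"
      using \<kappa> by (simp add: theta_exp_def joint_exp_def N c_def field_simps)
    also have "norm (sg2 r s) * norm (sg2 R l) * exp (- \<kappa> * (joint_exp t m r s R l + c * R))
        \<le> 1 * 1 * exp (- \<kappa> * ((\<bar>of_int r\<bar> + \<bar>of_int s\<bar> + \<bar>of_int R\<bar> + \<bar>of_int l\<bar>) / 4 - K))"
      using K [of r s R l] False \<kappa> by (intro mult_mono norm_sg2_le) auto
    also have "\<dots> = exp (\<kappa> * K) * (h r * h s * (h R * h l))"
      unfolding h_def exp_add [symmetric] by (simp add: field_simps)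
    finally show ?thesis .
  qed
  have "(\<lambda>y. norm (case y of (p, k) \<Rightarrow> joint_term \<tau> t m x p k)) summable_on opposite_parity \<times> UNIV"
    by (rule Infinite_Sum.abs_summable_on_comparison_test' [OF dom]) (use bound in auto)
  then show ?thesis
    by (rule abs_summable_summable)
qed

subsection \<open>Interchanging the summations\<close>

lemma exists_sg2_nonzero: "\<exists>R. sg2 R l \<noteq> 0"
  by (rule exI [of _ l]) (auto simp: sg2_def sg_def)

text \<open>The factor coming from the kernel adds \<open>l / 2\<close> to both linear coefficients,
  which amounts to replacing \<open>p = t\<close> by \<open>p = t + l\<close>.\<close>

lemma theta_term_linear_shift:
  assumes "odd (r - s)"
  shows "theta_term \<tau> t t m r s * qpow \<tau> (of_int ((r + s + 1) div 2) * of_int l)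
    = qpow \<tau> (of_int l / 2) * theta_term \<tau> t (t + l) m r s"
proof -
  have "theta_exp t t m r s + of_int ((r + s + 1) div 2) * of_int l
      = of_int l / 2 + theta_exp t (t + l) m r s"
    unfolding of_int_half_sum [OF assms] by (simp add: theta_exp_def field_simps)
  then show ?thesis
    unfolding theta_term_def by (simp only: mult.assoc qpow_add [symmetric]) (simp only: qpow_add mult_ac)
qed

text \<open>The part of the fourfold term that is independent of \<open>(r, s)\<close>; its extra
  \<open>l / 2\<close> comes from \<open>theta_term_linear_shift\<close>.\<close>

definition outer_coeff :: "complex \<Rightarrow> complex \<Rightarrow> int \<Rightarrow> int \<Rightarrow> complex" where
  "outer_coeff \<tau> x R l = sg2 R l * ((-1) powi (R + l)
    * qpow \<tau> (of_int ((R + l) * (R + l + 1)) / 2 + of_int l / 2) * x powi (- R))"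

lemma joint_term_conv:
  assumes "(r, s) \<in> opposite_parity"
  shows "joint_term \<tau> t m x (r, s) (R, l)
    = outer_coeff \<tau> x R l * (sg2 r s * theta_term \<tau> t (t + l) m r s)"
proof -
  have "theta_term \<tau> t t m r s * qpow \<tau> (of_int ((r + s + 1) div 2) * of_int l)
    = qpow \<tau> (of_int l / 2) * theta_term \<tau> t (t + l) m r s"
    using assms by (intro theta_term_linear_shift) (simp add: opposite_parity_iff)
  then have "sg2 r s * (sg2 R l * ((-1) powi (R + l) * (qpow \<tau> (of_int ((R + l) * (R + l + 1)) / 2) * x powi (- R))))
      * (theta_term \<tau> t t m r s * qpow \<tau> (of_int ((r + s + 1) div 2) * of_int l))
    = sg2 r s * (sg2 R l * ((-1) powi (R + l) * (qpow \<tau> (of_int ((R + l) * (R + l + 1)) / 2) * x powi (- R))))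
      * (qpow \<tau> (of_int l / 2) * theta_term \<tau> t (t + l) m r s)"
    by (rule arg_cong)
  then show ?thesis
    unfolding joint_term_def outer_coeff_def kernel_term_def prod.case qpow_add by (simp only: mult_ac)
qed

lemma joint_summable_swap:
  assumes "Im \<tau> > 0" "t \<ge> 2" "1 \<le> m" "m < t" "x \<noteq> 0"
  shows "(\<lambda>(k, y). joint_term \<tau> t m x y k) summable_on UNIV \<times> opposite_parity"
  using joint_summable [OF assms] unfolding summable_on_swap [of _ opposite_parity] by simp

text \<open>For \<open>x = 1\<close> and \<open>l = p - t\<close>, fixing \<open>(R, l)\<close> with
  nonzero sign in the fourfold series leaves a nonzero multiple of this series.\<close>

lemma theta_summable:
  assumes "Im \<tau> > 0" "t \<ge> 2" "1 \<le> m" "m < t"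
  shows "(\<lambda>(r, s). sg2 r s * theta_term \<tau> t p m r s) summable_on opposite_parity"
proof -
  define l where "l = p - t"
  obtain R where R: "sg2 R l \<noteq> 0" using exists_sg2_nonzero by blast
  have "(\<lambda>(k, y). joint_term \<tau> t m 1 y k) summable_on UNIV \<times> opposite_parity"
    by (rule joint_summable_swap) (use assms in auto)
  from summable_on_SigmaD1 [OF this, of "(R, l)"]
  have "(\<lambda>y. joint_term \<tau> t m 1 y (R, l)) summable_on opposite_parity"
    by simp
  also have "?this \<longleftrightarrow> (\<lambda>y. outer_coeff \<tau> 1 R l * (case y of (r, s) \<Rightarrow> sg2 r s * theta_term \<tau> t (t + l) m r s))
      summable_on opposite_parity"
    by (intro summable_on_cong) (auto simp: joint_term_conv)
  also have "\<dots> \<longleftrightarrow> (\<lambda>(r, s). sg2 r s * theta_term \<tau> t (t + l) m r s) summable_on opposite_parity"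
    using R by (intro summable_on_cmult_right') (simp add: outer_coeff_def)
  finally show ?thesis by (simp add: l_def)
qed

lemma kernel_summable:
  fixes t m :: int
  assumes "Im \<tau> > 0" "t \<ge> 2" "1 \<le> m" "m < t" "x \<noteq> 0"
    and rs: "(r, s) \<in> opposite_parity" "sg2 r s \<noteq> 0"
  shows "(\<lambda>(R, l). sg2 R l * kernel_term \<tau> x ((r + s + 1) div 2) R l) summable_on UNIV"
proof -
  from summable_on_SigmaD1 [OF joint_summable [OF assms(1-5)] rs(1)]
  have "(\<lambda>k. (sg2 r s * theta_term \<tau> t t m r s)
      * (case k of (R, l) \<Rightarrow> sg2 R l * kernel_term \<tau> x ((r + s + 1) div 2) R l)) summable_on UNIV"
    by (simp add: joint_term_def case_prod_unfold)
  then show ?thesis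
    using rs by (subst (asm) summable_on_cmult_right') (simp_all add: theta_term_def)
qed

lemma infsum_joint_term_kernel:
  assumes "Im \<tau> > 0" "t \<ge> 2" "1 \<le> m" "m < t" "x \<noteq> 0"
    and pole: "\<And>n :: int. n \<noteq> 0 \<Longrightarrow> x * qpow \<tau> (of_int n) \<noteq> 1"
    and rs: "(r, s) \<in> opposite_parity"
  shows "(\<Sum>\<^sub>\<infinity>k. joint_term \<tau> t m x (r, s) k) = Theta x (qpow \<tau> 1)
    * (sg2 r s * theta_term \<tau> t t m r s / (1 - x * qpow \<tau> (of_int (r + s + 1) / 2)))"
proof (cases "sg2 r s = 0")
  case True
  then show ?thesis by (simp add: joint_term_def case_prod_unfold)
next
  case False
  define N where "N = (r + s + 1) div 2"
  have N: "real_of_int N = of_int (r + s + 1) / 2"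
    unfolding N_def using rs by (intro of_int_half_sum) (simp add: opposite_parity_iff)
  \<comment> \<open>If \<open>r + s\<close> were -1, exactly one of the two would be negative and
    the sign would vanish. So \<open>N = 0\<close> does not occur, and \<open>x = 1\<close> is
    admissible.\<close>
  have "r + s \<noteq> -1"
    using False by (auto simp: sg2_def sg_def split: if_splits)
  then have "real_of_int (r + s + 1) \<noteq> 0"
    by linarith
  then have "N \<noteq> 0" using N by auto
  then have "1 - x * qpow \<tau> (of_int N) \<noteq> 0" using pole [of N] by simp
  moreover have "(1 - x * qpow \<tau> (of_int N)) * (\<Sum>\<^sub>\<infinity>(R, l). sg2 R l * kernel_term \<tau> x N R l)
      = Theta x (qpow \<tau> 1)"
    unfolding N_def by (intro kernel_sum kernel_summable [OF assms(1-5) rs False] assms)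
  ultimately have "(\<Sum>\<^sub>\<infinity>(R, l). sg2 R l * kernel_term \<tau> x N R l)
      = Theta x (qpow \<tau> 1) / (1 - x * qpow \<tau> (of_int N))"
    by (simp add: nonzero_eq_divide_eq mult.commute)
  moreover have "(\<Sum>\<^sub>\<infinity>k. joint_term \<tau> t m x (r, s) k) = sg2 r s * theta_term \<tau> t t m r s
      * (\<Sum>\<^sub>\<infinity>(R, l). sg2 R l * kernel_term \<tau> x N R l)"
    by (simp add: joint_term_def case_prod_unfold infsum_cmult_right' N_def)
  ultimately show ?thesis
    unfolding N [symmetric] by simp
qed

lemma infsum_joint_term_theta:
  "(\<Sum>\<^sub>\<infinity>y\<in>opposite_parity. joint_term \<tau> t m x y (R, l)) = outer_coeff \<tau> x R l * theta \<tau> t (t + l) m"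
proof -
  have "(\<Sum>\<^sub>\<infinity>y\<in>opposite_parity. joint_term \<tau> t m x y (R, l)) =
      (\<Sum>\<^sub>\<infinity>y\<in>opposite_parity. outer_coeff \<tau> x R l * (case y of (r, s) \<Rightarrow> sg2 r s * theta_term \<tau> t (t + l) m r s))"
    by (intro infsum_cong) (auto simp: joint_term_conv)
  then show ?thesis
    by (simp add: infsum_cmult_right' theta_conv_term)
qed

lemma g_conv_theta_term:
  "g \<tau> t m x = (\<Sum>\<^sub>\<infinity>(r, s)\<in>opposite_parity.
    sg2 r s * theta_term \<tau> t t m r s / (1 - x * qpow \<tau> (of_int (r + s + 1) / 2)))"
  by (simp add: g_def theta_term_def theta_exp_def opposite_parity_def mult.assoc)

text \<open>Fubini for the fourfold series: summing over \<open>(R, l)\<close> first gives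
  \<open>Theta\<close> times the terms of \<open>g\<close>, and summing over \<open>(r, s)\<close>
  first gives values of \<open>theta\<close>.\<close>

lemma Theta_times_g:
  assumes "Im \<tau> > 0" "t \<ge> 2" "1 \<le> m" "m < t" "x \<noteq> 0"
    and "\<And>n :: int. n \<noteq> 0 \<Longrightarrow> x * qpow \<tau> (of_int n) \<noteq> 1"
  shows "((\<lambda>(R, l). outer_coeff \<tau> x R l * theta \<tau> t (t + l) m)
    has_sum Theta x (qpow \<tau> 1) * g \<tau> t m x) UNIV"
proof -
  note sum = joint_summable [OF assms(1-5)] and sum' = joint_summable_swap [OF assms(1-5)]
  have "Theta x (qpow \<tau> 1) * g \<tau> t m x = (\<Sum>\<^sub>\<infinity>y\<in>opposite_parity. \<Sum>\<^sub>\<infinity>k. joint_term \<tau> t m x y k)"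
    unfolding g_conv_theta_term infsum_cmult_right' [symmetric]
    by (intro infsum_cong) (auto simp: infsum_joint_term_kernel [OF assms])
  also have "\<dots> = (\<Sum>\<^sub>\<infinity>k. \<Sum>\<^sub>\<infinity>y\<in>opposite_parity. joint_term \<tau> t m x y k)"
    using sum by (rule infsum_swap_banach)
  finally have "((\<lambda>k. \<Sum>\<^sub>\<infinity>y\<in>opposite_parity. joint_term \<tau> t m x y k)
      has_sum Theta x (qpow \<tau> 1) * g \<tau> t m x) UNIV"
    using summable_on_Sigma_banach [OF sum'] by (simp add: has_sum_infsum)
  then show ?thesis
    by (rule back_subst [of "\<lambda>f. (f has_sum _) _"]) (auto simp: infsum_joint_term_theta fun_eq_iff)
qed

section \<open>Collecting the series by residue classes of \<open>l\<close> modulo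
  \<open>2 * t\<close>\<close>

definition theta_coeff :: "complex \<Rightarrow> int \<Rightarrow> int \<Rightarrow> int \<Rightarrow> complex" where
  "theta_coeff \<tau> t m k =
    (-1) powi k * qpow \<tau> (1 / (4 * of_int t) * of_int (k - t) ^ 2) * theta \<tau> t (k - t) m"

text \<open>Replacing \<open>k - t\<close> by \<open>k + t\<close> raises the Gaussian exponent by
  exactly \<open>k\<close>, which is the exponent of the factor in \<open>theta_shift\<close> for
  \<open>p = k - t\<close>.\<close>

lemma theta_coeff_add:
  assumes "Im \<tau> > 0" "t \<ge> 2" "1 \<le> m" "m < t"
  shows "theta_coeff \<tau> t m (k + 2 * t) = theta_coeff \<tau> t m k"
proof -
  have "1 / (4 * of_int t) * of_int (k + 2 * t - t) ^ 2
      = 1 / (4 * of_int t) * of_int (k - t) ^ 2 + (of_int (t + (k - t)) :: real)"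
    using assms by (simp add: field_simps power2_eq_square)
  moreover have "(-1 :: complex) powi (k + 2 * t) = (-1) powi k"
    by (rule minus_one_powi_cong) simp
  moreover have "theta \<tau> t (k - t) m = qpow \<tau> (of_int (t + (k - t))) * theta \<tau> t (k - t + 2 * t) m"
    using assms by (intro theta_shift theta_summable)
  moreover have "k + 2 * t - t = k - t + 2 * t" by simp
  ultimately show ?thesis
    unfolding theta_coeff_def by (simp only: qpow_add mult_ac)
qed

lemma theta_coeff_cong:
  assumes "Im \<tau> > 0" "t \<ge> 2" "1 \<le> m" "m < t" "[l = k] (mod (2 * t))"
  shows "theta_coeff \<tau> t m l = theta_coeff \<tau> t m k"
proof -
  have *: "theta_coeff \<tau> t m (k + int n * (2 * t)) = theta_coeff \<tau> t m k" for k n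
  proof (induction n)
    case (Suc n)
    have "k + int (Suc n) * (2 * t) = k + int n * (2 * t) + 2 * t" by (simp add: algebra_simps)
    then show ?case by (simp only: theta_coeff_add [OF assms(1-4)] Suc.IH)
  qed simp
  from assms(5) have "2 * t dvd l - k"
    by (simp add: cong_iff_dvd_diff)
  then obtain j where "l - k = 2 * t * j"
    by (rule dvdE)
  then have j: "l = k + j * (2 * t)"
    by (simp add: algebra_simps)
  show ?thesis
  proof (cases "j \<ge> 0")
    case True
    then show ?thesis using * [of k "nat j"] j by simp
  next
    case False
    \<comment> \<open>A negative multiple is handled by climbing from \<open>l\<close> up to
      \<open>k\<close>.\<close>
    then show ?thesis using * [of l "nat (- j)"] j by simp
  qed
qed

definition inner_term :: "complex \<Rightarrow> int \<Rightarrow> complex \<Rightarrow> int \<Rightarrow> int \<Rightarrow> complex" where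
  "inner_term \<tau> t x r l = sg2 r l * (-1) powi r
    * qpow \<tau> (1/2 * of_int r ^ 2 + of_int l * of_int r
        + (2 * of_int t - 1) / (4 * of_int t) * of_int l ^ 2
        + 1/2 * of_int r + 1/2 * of_int l)
    * x powi (- r)"

text \<open>Quasi-periodicity moves \<open>theta\<close> from \<open>l - t\<close> to
  \<open>t + l\<close> and contributes the exponent \<open>l\<close>. The terms with denominator
  \<open>4 * t\<close> then combine to \<open>l^2 / 2 - l / 2 + t / 4\<close>.\<close>

lemma theta_coeff_times_inner_term:
  assumes "Im \<tau> > 0" "t \<ge> 2" "1 \<le> m" "m < t"
  shows "theta_coeff \<tau> t m l * inner_term \<tau> t x r l
    = qpow \<tau> (of_int t / 4) * (outer_coeff \<tau> x r l * theta \<tau> t (t + l) m)"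
proof -
  have shift: "theta \<tau> t (l - t) m = qpow \<tau> (of_int l) * theta \<tau> t (t + l) m"
    using theta_shift [where p = "l - t", OF assms(1) theta_summable [OF assms]]
    by (simp add: add.commute)
  have "1 / (4 * of_int t) * of_int (l - t) ^ 2 + of_int l
        + (1/2 * of_int r ^ 2 + of_int l * of_int r
        + (2 * of_int t - 1) / (4 * of_int t) * of_int l ^ 2
        + 1/2 * of_int r + 1/2 * of_int l)
      = of_int t / 4 + (of_int ((r + l) * (r + l + 1)) / 2 + (of_int l / 2 :: real))"
    using assms(2) by (simp add: field_simps power2_eq_square)
  from arg_cong [OF this, of "qpow \<tau>"]
  have *: "qpow \<tau> (1 / (4 * of_int t) * of_int (l - t) ^ 2) * qpow \<tau> (of_int l)
        * qpow \<tau> (1/2 * of_int r ^ 2 + of_int l * of_int r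
        + (2 * of_int t - 1) / (4 * of_int t) * of_int l ^ 2
        + 1/2 * of_int r + 1/2 * of_int l)
      = qpow \<tau> (of_int t / 4) * qpow \<tau> (of_int ((r + l) * (r + l + 1)) / 2 + of_int l / 2)"
    by (simp only: qpow_add [of \<tau> "1 / (4 * of_int t) * of_int (l - t) ^ 2 + of_int l"]
        qpow_add [of \<tau> "1 / (4 * of_int t) * of_int (l - t) ^ 2" "of_int l"] qpow_add [of \<tau> "of_int t / 4"])
  have sign: "(-1 :: complex) powi (r + l) = (-1) powi l * (-1) powi r"
    by (simp add: power_int_add)
  have "theta_coeff \<tau> t m l * inner_term \<tau> t x r l
    = (qpow \<tau> (1 / (4 * of_int t) * of_int (l - t) ^ 2) * qpow \<tau> (of_int l)
        * qpow \<tau> (1/2 * of_int r ^ 2 + of_int l * of_int r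
        + (2 * of_int t - 1) / (4 * of_int t) * of_int l ^ 2
        + 1/2 * of_int r + 1/2 * of_int l))
      * (sg2 r l * ((-1) powi l * (-1) powi r) * x powi (- r) * theta \<tau> t (t + l) m)"
    unfolding theta_coeff_def inner_term_def shift by (simp only: mult_ac)
  also have "\<dots> = qpow \<tau> (of_int t / 4) * (outer_coeff \<tau> x r l * theta \<tau> t (t + l) m)"
    unfolding * outer_coeff_def sign by (simp only: mult_ac)
  finally show ?thesis .
qed

text \<open>The strips given by the classes of \<open>l\<close> partition the lattice: injectivity
  of reduction on \<open>K\<close> makes them disjoint, surjectivity makes them cover.\<close>

lemma sum_complete_residues:
  fixes F :: "int \<times> int \<Rightarrow> complex"
  assumes "n > 0" "complete_residues n K" "(F has_sum S) UNIV"
  shows "(\<Sum>k\<in>K. \<Sum>\<^sub>\<infinity>p\<in>{(r, l). [l = k] (mod n)}. F p) = S"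
proof -
  have bij: "bij_betw (\<lambda>k. k mod n) K {0..<n}"
    using assms by (simp add: complete_residues_def)
  have fin: "finite K"
    using bij_betw_finite [OF bij] by simp
  have "F summable_on UNIV" using assms by (auto simp: summable_on_def)
  then have sum: "F summable_on A" for A
    by (rule summable_on_subset) simp
  have "(\<Sum>k\<in>K. \<Sum>\<^sub>\<infinity>p\<in>{(r, l). [l = k] (mod n)}. F p) = infsum F (\<Union>k\<in>K. {(r, l). [l = k] (mod n)})"
  proof (rule sum_infsum [OF fin sum])
    fix a b assume "a \<in> K" "b \<in> K" "a \<noteq> b"
    then have "a mod n \<noteq> b mod n"
      using bij by (auto simp: bij_betw_def inj_on_def)
    then show "{(r :: int, l). [l = a] (mod n)} \<inter> {(r, l). [l = b] (mod n)} = {}"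
      by (auto simp: cong_def)
  qed
  also have "(\<Union>k\<in>K. {(r :: int, l). [l = k] (mod n)}) = UNIV"
  proof -
    have "\<exists>k\<in>K. [l = k] (mod n)" for l
    proof -
      have "l mod n \<in> (\<lambda>k. k mod n) ` K"
        using bij assms(1) by (simp add: bij_betw_def)
      then show ?thesis by (auto simp: cong_def)
    qed
    then show ?thesis by auto
  qed
  finally show ?thesis
    using assms(3) infsumI by metis
qed

theorem theorem1p7:
  fixes \<tau> x :: complex and t m :: int and K :: "int set"
  assumes "Im \<tau> > 0"
    and "t \<ge> 2" and "1 \<le> m" and "m < t"
    and "x \<noteq> 0"
    and "\<And>n :: int. n \<noteq> 0 \<Longrightarrow> x * qpow \<tau> (of_int n) \<noteq> 1"
    and "complete_residues (2 * t) K"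
  shows "f \<tau> t m x =
    - (qpow \<tau> (- 3/4 * of_int t - of_int m / 2 + 7/8)
        / qpoch_inf (qpow \<tau> 1) (qpow \<tau> 1) ^ 3)
    * (\<Sum>k\<in>K. (-1) powi k * qpow \<tau> (1 / (4 * of_int t) * of_int (k - t) ^ 2)
        * theta \<tau> t (k - t) m
        * (\<Sum>\<^sub>\<infinity>(r, l) \<in> {(r, l). [l = k] (mod (2 * t))}.
            sg2 r l * (-1) powi r
            * qpow \<tau> (1/2 * of_int r ^ 2 + of_int l * of_int r
                + (2 * of_int t - 1) / (4 * of_int t) * of_int l ^ 2
                + 1/2 * of_int r + 1/2 * of_int l)
            * x powi (- r)))"
proof -
  define F where "F = (\<lambda>(r, l). theta_coeff \<tau> t m l * inner_term \<tau> t x r l)"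
  define S where "S = Theta x (qpow \<tau> 1) * g \<tau> t m x"
  have "((\<lambda>(r, l). qpow \<tau> (of_int t / 4) * (outer_coeff \<tau> x r l * theta \<tau> t (t + l) m))
      has_sum qpow \<tau> (of_int t / 4) * S) UNIV"
    using has_sum_cmult_right [OF Theta_times_g [OF assms(1-6)], of "qpow \<tau> (of_int t / 4)"]
    by (simp add: S_def case_prod_unfold)
  then have F: "(F has_sum qpow \<tau> (of_int t / 4) * S) UNIV"
    by (simp add: F_def theta_coeff_times_inner_term [OF assms(1-4)])
  have "(\<Sum>k\<in>K. theta_coeff \<tau> t m k * (\<Sum>\<^sub>\<infinity>(r, l)\<in>{(r, l). [l = k] (mod (2 * t))}. inner_term \<tau> t x r l))
      = (\<Sum>k\<in>K. \<Sum>\<^sub>\<infinity>p\<in>{(r, l). [l = k] (mod (2 * t))}. F p)"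
  proof (rule sum.cong [OF refl])
    fix k
    show "theta_coeff \<tau> t m k * (\<Sum>\<^sub>\<infinity>(r, l)\<in>{(r, l). [l = k] (mod (2 * t))}. inner_term \<tau> t x r l)
        = (\<Sum>\<^sub>\<infinity>p\<in>{(r, l). [l = k] (mod (2 * t))}. F p)"
      \<comment> \<open>Within one residue class the coefficient at \<open>k\<close> may be replaced
        by the one at \<open>l\<close>.\<close>
      unfolding infsum_cmult_right' [symmetric] F_def
      using theta_coeff_cong [OF assms(1-4)] by (intro infsum_cong) auto
  qed
  also have "\<dots> = qpow \<tau> (of_int t / 4) * S"
    using assms(2) by (intro sum_complete_residues assms(7) F) simp
  finally have rhs: "(\<Sum>k\<in>K. theta_coeff \<tau> t m k
      * (\<Sum>\<^sub>\<infinity>(r, l)\<in>{(r, l). [l = k] (mod (2 * t))}. inner_term \<tau> t x r l)) = qpow \<tau> (of_int t / 4) * S" .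
  \<comment> \<open>The surplus \<open>t / 4\<close> from the completed exponents accounts for the
    passage from \<open>- t / 2\<close> to \<open>- 3/4 * t\<close> in the prefactor.\<close>
  have "- of_int t / 2 - of_int m / 2 + 7/8
      = (- 3/4 * of_int t - of_int m / 2 + 7/8) + (of_int t / 4 :: real)"
    by simp
  then have "qpow \<tau> (- of_int t / 2 - of_int m / 2 + 7/8)
      = qpow \<tau> (- 3/4 * of_int t - of_int m / 2 + 7/8) * qpow \<tau> (of_int t / 4)"
    by (simp only: qpow_add)
  then have "f \<tau> t m x = - (qpow \<tau> (- 3/4 * of_int t - of_int m / 2 + 7/8)
        / qpoch_inf (qpow \<tau> 1) (qpow \<tau> 1) ^ 3) * (qpow \<tau> (of_int t / 4) * S)"
    by (simp add: f_def S_def)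
  also have "\<dots> = - (qpow \<tau> (- 3/4 * of_int t - of_int m / 2 + 7/8)
        / qpoch_inf (qpow \<tau> 1) (qpow \<tau> 1) ^ 3) * (\<Sum>k\<in>K. theta_coeff \<tau> t m k
      * (\<Sum>\<^sub>\<infinity>(r, l)\<in>{(r, l). [l = k] (mod (2 * t))}. inner_term \<tau> t x r l))"
    unfolding rhs ..
  finally show ?thesis
    unfolding theta_coeff_def inner_term_def .
qed

end
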